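(* Let $\phi$ be a self-map of $\mathbb{H}$ of parabolic zero-step type, let $z_0\in\mathbb{H}$, $z_n=\phi_n(z_0)$, and let $h$ be the Baker–Pommerenke semiconjugation of $\phi$ based at $z_0$. Given a solution $(\sigma,\tau)\in\mathcal{P}(\phi)$, let $\tilde\beta$ be the automorphism of $\mathbb{C}$ which conjugates $\tau$ to its standard form, i.e. $\tilde\beta^{-1}\circ\tau\circ\tilde\beta$ is either $z\mapsto z+1$ or $z\mapsto az$ with $a\in\mathbb{C}\setminus\{0\}$. Then the following are equivalent: (a) There is $b\in\mathbb{C}$ such that $\tau(z)=z+b$, $\tilde\beta(z)=bz$, and $\sigma=b(h+c)$ for some $c\in\mathbb{C}$. (b) $\sigma$ is canonical. (c) The function $f=\tilde\beta^{-1}\circ\sigma$ has the same univalence and covering properties as $h$, namely: sequences $R_k\uparrow+\infty$ (positive reals) and $M_k\uparrow+\infty$ (positive integers) can be chosen so that $f$ is univalent on the set $$U=\bigcup_{k=1}^{\infty}\bigcup_{n=M_k}^{\infty}\big(z_n+(z_{n+1}-z_n)R_k\mathbb{D}\big)\subset\mathbb{H},$$ and the region $f(U)$ has a lateral-tangent at $+\infty$ with respect to $\mathbb{C}$.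
   Context: $\mathbb{H}=\{z\in\mathbb{C}:\operatorname{Im}z>0\}$, $\mathbb{D}$ is the open unit disk, $\rho_{\mathbb{H}}$ is the hyperbolic distance, $\phi_n$ is the $n$-th iterate of $\phi$, and $\operatorname{Aut}(\mathbb{C})=\{z\mapsto az+b: a\neq0\}$. n.t.-lim as $z\to\infty$ means the limit as $z\to\infty$ inside each sector $\{|\operatorname{Arg}z-\pi/2|<\theta\}$, $0<\theta<\pi/2$. A self-map of $\mathbb{H}$ of parabolic zero-step type is an analytic map $\phi:\mathbb{H}\to\mathbb{H}$, not an automorphism, of the form $\phi(z)=z+p(z)$ with $\operatorname{Im}p>0$ on $\mathbb{H}$ and n.t.-$\lim_{z\to\infty}p(z)/z=0$, such that $\rho_{\mathbb{H}}(\phi_n(z),\phi_{n+1}(z))\to0$ for one (equivalently, every) $z\in\mathbb{H}$. Baker–Pommerenke semiconjugation based at $z_0$: let $z_n=\phi_n(z_0)$ and $\mu_n(z)=\frac{z-z_n}{z_{n+1}-z_n}$. By a theorem of Baker and Pommerenke, $h=\lim_{n}\mu_n\circ\phi_n$ exists locally uniformly in $\mathbb{H}$, $h(z_0)=0$, and $h\circ\phi=h+1$. $\mathcal{P}(\phi)$ is the set of pairs $(\sigma,\tau)$ with $\sigma:\mathbb{H}\to\mathbb{C}$ analytic and non-constant, $\tau\in\operatorname{Aut}(\mathbb{C})$, and $\sigma\circ\phi=\tau\circ\sigma$. Two points $z,w$ are in the same grand orbit of a map $\psi$ if $\psi_n(z)=\psi_k(w)$ for some integers $n,k\ge0$; $\mathcal{G}(\psi)$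 is the set of grand orbits ($\phi$ acting on $\mathbb{H}$, $\tau$ acting on $\mathbb{C}$). If $(\sigma,\tau)\in\mathcal{P}(\phi)$, then $\sigma$ induces a map $\mathcal{G}(\phi)\to\mathcal{G}(\tau)$; $\sigma$ is canonical if this map is a bijection. A set $V\subset\mathbb{C}$ has a lateral-tangent at $+\infty$ with respect to $\mathbb{C}$ if, given $r_n\uparrow+\infty$, there is $t_n\uparrow+\infty$ such that $\{\operatorname{Re}z>t_n,\ |\operatorname{Im}z|<r_n\}\subset V$ for all $n$.
   Formalization: When the standard form of τ is z ↦ z+1, the conjugating automorphism β̃ is unique only up to an additive constant; it is normalised here by β̃(0)=0, without which (b) would not imply β̃(z)=bz in (a). *)

theory Defs
  imports "HOL-Complex_Analysis.Complex_Analysis"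
begin

definition uhp :: "complex set" where
  "uhp = {z. Im z > 0}"

text \<open>Hyperbolic distance of the upper half-plane, normalised to curvature \<open>-1\<close>; the argument of
  \<open>artanh\<close> is the pseudo-hyperbolic distance of \<open>z\<close> and \<open>w\<close>.\<close>

definition hyp_dist :: "complex \<Rightarrow> complex \<Rightarrow> real" where
  "hyp_dist z w = 2 * artanh (cmod (z - w) / cmod (z - cnj w))"

text \<open>Non-tangential limit at infinity. Each sector lies in the upper half-plane, because
  \<open>Arg\<close> is the principal argument (with \<open>Arg 0 = 0\<close>) and \<open>\<theta> < pi / 2\<close>.\<close>

definition nt_tendsto :: "(complex \<Rightarrow> complex) \<Rightarrow> complex \<Rightarrow> bool" where
  "nt_tendsto g l \<longleftrightarrow>
     (\<forall>\<theta>. 0 < \<theta> \<and> \<theta> < pi / 2 \<longrightarrow>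
        (g \<longlongrightarrow> l) (inf at_infinity (principal {z. \<bar>Arg z - pi / 2\<bar> < \<theta>})))"

text \<open>Self-maps of the half-plane are total functions of which only the values on \<^const>\<open>uhp\<close> matter.
  The zero-step condition is required for one orbit only.\<close>

definition parabolic_zero_step :: "(complex \<Rightarrow> complex) \<Rightarrow> bool" where
  "parabolic_zero_step \<phi> \<longleftrightarrow>
     \<phi> holomorphic_on uhp \<and> \<phi> ` uhp \<subseteq> uhp \<and> \<not> bij_betw \<phi> uhp uhp \<and>
     (\<exists>p. (\<forall>z\<in>uhp. \<phi> z = z + p z \<and> Im (p z) > 0) \<and> nt_tendsto (\<lambda>z. p z / z) 0) \<and>
     (\<exists>z\<in>uhp. (\<lambda>n. hyp_dist ((\<phi> ^^ n) z) ((\<phi> ^^ Suc n) z)) \<longlonglongrightarrow> 0)"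

definition BP_mu :: "(complex \<Rightarrow> complex) \<Rightarrow> complex \<Rightarrow> nat \<Rightarrow> complex \<Rightarrow> complex" where
  "BP_mu \<phi> z0 n z = (z - (\<phi> ^^ n) z0) / ((\<phi> ^^ Suc n) z0 - (\<phi> ^^ n) z0)"

text \<open>\<open>h\<close> is the Baker--Pommerenke semiconjugation of \<open>\<phi>\<close> based at \<open>z0\<close>. This determines \<open>h\<close> on
  \<^const>\<open>uhp\<close>; the relations \<open>h z0 = 0\<close> and \<open>h \<circ> \<phi> = h + 1\<close> are consequences.\<close>

definition BP_semiconj :: "(complex \<Rightarrow> complex) \<Rightarrow> complex \<Rightarrow> (complex \<Rightarrow> complex) \<Rightarrow> bool" where
  "BP_semiconj \<phi> z0 h \<longleftrightarrow>
     (\<forall>K. compact K \<and> K \<subseteq> uhp \<longrightarrow>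
        uniform_limit K (\<lambda>n. BP_mu \<phi> z0 n \<circ> (\<phi> ^^ n)) h sequentially)"

definition AutC :: "(complex \<Rightarrow> complex) set" where
  "AutC = {\<tau>. \<exists>a b. a \<noteq> 0 \<and> \<tau> = (\<lambda>z. a * z + b)}"

definition semiconj_solutions ::
    "(complex \<Rightarrow> complex) \<Rightarrow> ((complex \<Rightarrow> complex) \<times> (complex \<Rightarrow> complex)) set" where
  "semiconj_solutions \<phi> =
     {(\<sigma>, \<tau>). \<sigma> holomorphic_on uhp \<and> \<not> \<sigma> constant_on uhp \<and> \<tau> \<in> AutC \<and>
              (\<forall>z\<in>uhp. \<sigma> (\<phi> z) = \<tau> (\<sigma> z))}"

definition grand_orbit_rel :: "'a set \<Rightarrow> ('a \<Rightarrow> 'a) \<Rightarrow> ('a \<times> 'a) set" where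
  "grand_orbit_rel X \<psi> = {(z, w). z \<in> X \<and> w \<in> X \<and> (\<exists>n k. (\<psi> ^^ n) z = (\<psi> ^^ k) w)}"

definition grand_orbits :: "'a set \<Rightarrow> ('a \<Rightarrow> 'a) \<Rightarrow> 'a set set" where
  "grand_orbits X \<psi> = X // grand_orbit_rel X \<psi>"

text \<open>The map induced by \<open>\<sigma>\<close> sends a grand orbit \<open>A\<close> of \<open>\<phi>\<close> to the saturation of \<open>\<sigma> ` A\<close> under
  the grand orbit relation of \<open>\<tau>\<close>. If \<open>\<sigma> \<circ> \<phi> = \<tau> \<circ> \<sigma>\<close>, this is a single grand orbit of \<open>\<tau>\<close>,
  namely the one containing \<open>\<sigma> z\<close> for every \<open>z \<in> A\<close>.\<close>

definition induced_map :: "(complex \<Rightarrow> complex) \<Rightarrow> (complex \<Rightarrow> complex) \<Rightarrow> complex set \<Rightarrow> complex set" where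
  "induced_map \<sigma> \<tau> A = grand_orbit_rel UNIV \<tau> `` (\<sigma> ` A)"

definition canonical ::
    "(complex \<Rightarrow> complex) \<Rightarrow> (complex \<Rightarrow> complex) \<Rightarrow> (complex \<Rightarrow> complex) \<Rightarrow> bool" where
  "canonical \<phi> \<sigma> \<tau> \<longleftrightarrow>
     bij_betw (induced_map \<sigma> \<tau>) (grand_orbits uhp \<phi>) (grand_orbits UNIV \<tau>)"

text \<open>\<open>\<beta>\<close> conjugates \<open>\<tau>\<close> to its standard form. If the standard form is \<open>z \<mapsto> z + 1\<close>, then \<open>\<beta>\<close> is
  unique only up to an additive constant; it is made unique by \<open>\<beta> 0 = 0\<close>.
  The identity has the standard form \<open>z \<mapsto> 1 * z\<close>.\<close>

definition standardizes :: "(complex \<Rightarrow> complex) \<Rightarrow> (complex \<Rightarrow> complex) \<Rightarrow> bool" where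
  "standardizes \<beta> \<tau> \<longleftrightarrow>
     \<beta> \<in> AutC \<and>
     ((inv \<beta> \<circ> \<tau> \<circ> \<beta> = (\<lambda>z. z + 1) \<and> \<beta> 0 = 0) \<or>
      (\<exists>a. a \<noteq> 0 \<and> inv \<beta> \<circ> \<tau> \<circ> \<beta> = (\<lambda>z. a * z)))"

definition lateral_tangent :: "complex set \<Rightarrow> bool" where
  "lateral_tangent V \<longleftrightarrow>
     (\<forall>r :: nat \<Rightarrow> real. incseq r \<and> filterlim r at_top sequentially \<longrightarrow>
        (\<exists>t :: nat \<Rightarrow> real. incseq t \<and> filterlim t at_top sequentially \<and>
           (\<forall>n. {z. Re z > t n \<and> \<bar>Im z\<bar> < r n} \<subseteq> V)))"

text \<open>The union of the discs \<open>z\<^sub>n + (z\<^sub>n\<^sub>+\<^sub>1 - z\<^sub>n) R\<^sub>k \<D>\<close> over all \<open>k\<close> and all \<open>n \<ge> M\<^sub>k\<close>,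
  where \<open>z\<^sub>n\<close> is the orbit of \<open>z0\<close> and \<open>\<D>\<close> is the open unit disc; the index \<open>k\<close> starts at \<open>0\<close>.\<close>

definition disc_union ::
    "(complex \<Rightarrow> complex) \<Rightarrow> complex \<Rightarrow> (nat \<Rightarrow> real) \<Rightarrow> (nat \<Rightarrow> nat) \<Rightarrow> complex set" where
  "disc_union \<phi> z0 R M =
     (\<Union>k. \<Union>n\<in>{M k..}.
        (\<lambda>w. (\<phi> ^^ n) z0 + ((\<phi> ^^ Suc n) z0 - (\<phi> ^^ n) z0) * of_real (R k) * w) ` ball 0 1)"

definition univalence_covering ::
    "(complex \<Rightarrow> complex) \<Rightarrow> complex \<Rightarrow> (complex \<Rightarrow> complex) \<Rightarrow> bool" where
  "univalence_covering \<phi> z0 f \<longleftrightarrow>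
     (\<exists>(R :: nat \<Rightarrow> real) (M :: nat \<Rightarrow> nat).
        (\<forall>k. R k > 0) \<and> incseq R \<and> filterlim R at_top sequentially \<and>
        (\<forall>k. M k > 0) \<and> incseq M \<and> filterlim M at_top sequentially \<and>
        disc_union \<phi> z0 R M \<subseteq> uhp \<and>
        f holomorphic_on disc_union \<phi> z0 R M \<and> inj_on f (disc_union \<phi> z0 R M) \<and>
        lateral_tangent (f ` disc_union \<phi> z0 R M))"

end

theory Submission
  imports Defs
begin

text \<open>Both \<open>\<phi>\<close> and \<open>p z = \<phi> z - z\<close> map the half-plane into itself. Schwarz--Pick for \<open>p\<close> shows that \<open>\<phi>\<close> is
  injective wherever \<open>|p z| < Im z\<close>, in particular on the forward invariant set \<open>V\<close> of points that
  \<open>\<phi>\<close> moves by a small pseudo-hyperbolic distance. Hence all iterates are injective on \<open>V\<close>, and by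
  Hurwitz \<open>h\<close> is univalent on discs around \<open>z\<^sub>n\<close> whose radii are arbitrarily large compared with
  \<open>|z\<^sub>n\<^sub>+\<^sub>1 - z\<^sub>n|\<close>. Distortion makes \<open>h\<close> asymptotically affine there, so that \<open>h\<close> is canonical and has
  the covering property.

  Any other solution \<open>f\<close>, with \<open>\<tau>\<close> in its standard form \<open>T\<close>, factors as \<open>f = F \<circ> h\<close>, where \<open>F\<close> is entire
  and \<open>F (w + 1) = T (F w)\<close>: put \<open>F w = T\<^sup>-\<^sup>n (f z)\<close> if \<open>h z = w + n\<close>. Conditions (b) and (c) each make \<open>F\<close>
  injective, hence affine, hence a translation.\<close>

subsection \<open>Schwarz--Pick in the upper half-plane\<close>

lemma uhp_open: "open uhp"
  unfolding uhp_def by (rule open_halfspace_Im_gt)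

lemma uhp_minus_cnj_nonzero: "z \<in> uhp \<Longrightarrow> w \<in> uhp \<Longrightarrow> z - cnj w \<noteq> 0"
  by (auto simp: uhp_def complex_eq_iff)

lemma cmod_cayley_less_1:
  assumes "z \<in> uhp" "w \<in> uhp"
  shows "cmod ((z - w) / (z - cnj w)) < 1"
proof -
  have "(Im z - Im w)\<^sup>2 < (Im z + Im w)\<^sup>2"
    using assms by (intro power_strict_mono[of "\<bar>Im z - Im w\<bar>" "Im z + Im w" 2, simplified])
      (auto simp: uhp_def)
  then have "cmod (z - w) < cmod (z - cnj w)"
    by (simp add: cmod_def)
  then show ?thesis
    by (simp add: norm_divide divide_less_eq_1)
qed

text \<open>Cayley transforms in source and target reduce this to the Schwarz lemma on the unit
  disc. The cross-multiplied form avoids quotients in later estimates.\<close>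

theorem Schwarz_Pick_uhp:
  assumes f: "f holomorphic_on uhp" and im: "f ` uhp \<subseteq> uhp"
    and z: "z \<in> uhp" and w: "w \<in> uhp"
  shows "cmod (f z - f w) * cmod (z - cnj w) \<le> cmod (z - w) * cmod (f z - cnj (f w))"
proof -
  \<comment> \<open>\<open>P\<close> is the inverse of the Cayley map
    \<open>z \<mapsto> (z - w) / (z - cnj w)\<close>; it sends the unit disc into \<open>uhp\<close>
    and 0 to \<open>w\<close>.\<close>
  define P where "P u = (w - cnj w * u) / (1 - u)" for u
  define G where "G u = (f (P u) - f w) / (f (P u) - cnj (f w))" for u
  define u where "u = (z - w) / (z - cnj w)"
  have P_uhp: "P v \<in> uhp" if "cmod v < 1" for v
  proof -
    have v1: "v \<noteq> 1"
      using that by auto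
    have "Im (P v) = Im ((w - cnj w * v) * cnj (1 - v)) / (cmod (1 - v))\<^sup>2"
      unfolding P_def by (subst complex_div_cnj) (simp del: complex_cnj_diff)
    also have "Im ((w - cnj w * v) * cnj (1 - v)) = Im w * (1 - (cmod v)\<^sup>2)"
      unfolding cmod_power2 by (simp add: algebra_simps power2_eq_square)
    finally show ?thesis
      using that w v1 by (simp add: uhp_def abs_square_less_1)
  qed
  have fw: "f w \<in> uhp"
    using im w by auto
  have fP: "f (P v) \<in> uhp" if "cmod v < 1" for v
    using P_uhp[OF that] im by auto
  have u: "cmod u < 1"
    unfolding u_def by (rule cmod_cayley_less_1[OF z w])
  have "z - cnj w \<noteq> 0" "w - cnj w \<noteq> 0"
    by (rule uhp_minus_cnj_nonzero; fact)+
  then have Pu: "P u = z"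
    unfolding P_def u_def by (simp add: divide_simps) (simp add: algebra_simps)
  have "G holomorphic_on ball 0 1"
    unfolding G_def
  proof (intro holomorphic_intros)
    have "P holomorphic_on ball 0 1"
      unfolding P_def by (intro holomorphic_intros) auto
    then have "(f \<circ> P) holomorphic_on ball 0 1"
      by (rule holomorphic_on_compose_gen[OF _ f]) (use P_uhp in auto)
    then show "(\<lambda>x. f (P x)) holomorphic_on ball 0 1" by (simp add: o_def)
    then show "(\<lambda>x. f (P x)) holomorphic_on ball 0 1" .
    show "f (P v) - cnj (f w) \<noteq> 0" if "v \<in> ball 0 1" for v
      using uhp_minus_cnj_nonzero[OF fP fw] that by simp
  qed
  moreover have "G 0 = 0"
    by (simp add: G_def P_def)
  moreover have "cmod (G v) < 1" if "cmod v < 1" for v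
    unfolding G_def by (rule cmod_cayley_less_1[OF fP[OF that] fw])
  ultimately have "cmod (G u) \<le> cmod u"
    using Schwarz_Lemma(1) u by blast
  moreover have "f z - cnj (f w) \<noteq> 0"
    by (rule uhp_minus_cnj_nonzero) (use z im fw in auto)
  ultimately show ?thesis
    using \<open>z - cnj w \<noteq> 0\<close> Pu
    by (simp add: G_def u_def norm_divide divide_simps mult.commute split: if_splits)
qed

lemma cmod_diff_cnj_commute: "cmod (z - cnj w) = cmod (w - cnj z)"
  by (metis complex_cnj_cnj complex_cnj_diff complex_mod_cnj norm_minus_commute)

lemma cmod_diff_cnj_le: "Im w \<ge> 0 \<Longrightarrow> cmod (z - cnj w) \<le> cmod (z - w) + 2 * Im w"
proof -
  assume "Im w \<ge> 0"
  moreover have "z - cnj w = (z - w) + (w - cnj w)" by simp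
  moreover have "cmod (w - cnj w) = 2 * \<bar>Im w\<bar>"
    by (simp add: complex_diff_cnj norm_mult)
  ultimately show ?thesis
    by (metis abs_of_nonneg norm_triangle_ineq)
qed

lemma Im_add_le_cmod_diff_cnj: "Im z + Im w \<le> cmod (z - cnj w)"
  using abs_Im_le_cmod[of "z - cnj w"] by simp

text \<open>From |a - cnj b| <= |a| + |b|, after collecting the terms in |a|. Applied to values of
  \<open>p\<close>, it makes steps at pseudo-hyperbolically close points comparable.\<close>

lemma cmod_le_of_pseudo_hyp:
  assumes "0 \<le> k" "k < 1" "cmod (a - b) \<le> k * cmod (a - cnj b)"
  shows "cmod a \<le> (1 + k) / (1 - k) * cmod b"
proof -
  have "cmod a \<le> cmod b + k * (cmod a + cmod b)"
    using assms norm_triangle_ineq2[of a b] norm_triangle_ineq4[of a "cnj b"]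
      mult_left_mono[of "cmod (a - cnj b)" "cmod a + cmod b" k] by simp
  then show ?thesis
    using assms by (simp add: field_simps)
qed

text \<open>The analogue for heights, from |a - cnj b| <= |a - b| + 2 Im b.\<close>

lemma Im_le_of_pseudo_hyp:
  assumes "0 \<le> k" "k < 1" "cmod (a - b) \<le> k * cmod (a - cnj b)" "Im b \<ge> 0"
  shows "Im a \<le> (1 + k) / (1 - k) * Im b"
proof -
  have "cmod (a - b) \<le> k * (cmod (a - b) + 2 * Im b)"
    using assms cmod_diff_cnj_le[of b a] mult_left_mono[of "cmod (a - cnj b)" "cmod (a - b) + 2 * Im b" k]
    by simp
  then have "(1 - k) * cmod (a - b) \<le> 2 * k * Im b"
    by (simp add: algebra_simps)
  moreover have "(1 - k) * (Im a - Im b) \<le> (1 - k) * cmod (a - b)"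
    using assms abs_Im_le_cmod[of "a - b"] by (intro mult_left_mono) auto
  ultimately have "(1 - k) * Im a \<le> (1 + k) * Im b"
    by (simp add: algebra_simps)
  then show ?thesis
    using assms by (simp add: field_simps)
qed

text \<open>Follows from ln x <= x - 1 at x = (1 - s) / (1 + s), because 2 artanh s = - ln
  x.\<close>

lemma pseudo_hyp_le_hyp_dist:
  assumes "z \<in> uhp" "w \<in> uhp"
  shows "cmod (z - w) / cmod (z - cnj w) \<le> hyp_dist z w"
proof -
  define s where "s = cmod (z - w) / cmod (z - cnj w)"
  have s: "0 \<le> s" "s < 1"
    using cmod_cayley_less_1[OF assms] by (auto simp: s_def norm_divide)
  have "ln ((1 - s) / (1 + s)) \<le> (1 - s) / (1 + s) - 1"
    using s by (intro ln_le_minus_one) auto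
  moreover have "ln ((1 - s) / (1 + s)) = - ln ((1 + s) / (1 - s))"
    using s by (simp add: ln_div)
  moreover have "s \<le> 1 - (1 - s) / (1 + s)"
    using s mult_left_mono[of s 1 s] by (simp add: field_simps)
  ultimately have "s \<le> 2 * artanh s"
    by (simp add: artanh_def)
  then show ?thesis
    by (simp add: hyp_dist_def s_def)
qed

subsection \<open>Distortion of univalent functions\<close>

text \<open>Otherwise the inverse \<open>g\<close> of \<open>f\<close>, rescaled to
  \<open>g (2 * a * u)\<close> with \<open>a = deriv f 0\<close>, would be a self-map of the disc
  fixing 0 with derivative of modulus 2, against the Schwarz lemma.\<close>

lemma univalent_omits_value:
  assumes f: "f holomorphic_on ball 0 1" and inj: "inj_on f (ball 0 1)" and f0: "f 0 = 0"
  obtains w where "w \<notin> f ` ball 0 1" "w \<noteq> 0" "cmod w \<le> 2 * cmod (deriv f 0)"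
proof -
  obtain g where g: "g holomorphic_on f ` ball 0 1"
    and d: "\<And>z. z \<in> ball 0 1 \<Longrightarrow> deriv f z * deriv g (f z) = 1"
    and gf: "\<And>z. z \<in> ball 0 1 \<Longrightarrow> g (f z) = z"
    by (rule holomorphic_has_inverse[OF f open_ball inj]) blast
  define a where "a = deriv f 0"
  have a: "a * deriv g 0 = 1"
    using d[of 0] f0 by (simp add: a_def)
  then have a0: "a \<noteq> 0" by auto
  have "\<exists>w. w \<notin> f ` ball 0 1 \<and> cmod w \<le> 2 * cmod a"
  proof (rule ccontr)
    assume "\<not> ?thesis"
    then have cov: "w \<in> f ` ball 0 1" if "cmod w \<le> 2 * cmod a" for w
      using that by blast
    have sub: "2 * a * u \<in> f ` ball 0 1" if "cmod u < 1" for u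
      using that a0 by (intro cov) (auto simp: norm_mult)
    define k where "k u = g (2 * a * u)" for u
    have kh: "k holomorphic_on ball 0 1"
      unfolding k_def using sub
      by (intro holomorphic_on_compose_gen[of "\<lambda>u. 2 * a * u" _ g, unfolded o_def, OF _ g]
          holomorphic_intros) auto
    have "k 0 = 0"
      using gf[of 0] f0 by (simp add: k_def)
    moreover have "cmod (k u) < 1" if "cmod u < 1" for u
      using sub[OF that] gf by (auto simp: k_def)
    ultimately have "cmod (deriv k 0) \<le> 1"
      by (rule Schwarz_Lemma(2)[OF kh _ _ norm_zero[THEN ord_eq_less_trans, OF zero_less_one]])
    moreover have "(k has_field_derivative deriv g 0 * (2 * a)) (at 0)"
    proof -
      have "g field_differentiable at (2 * a * 0)"
        using g open_mapping_thm3[OF f open_ball inj] sub[of 0]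
        by (auto intro: holomorphic_on_imp_differentiable_at)
      then have "(g has_field_derivative deriv g 0) (at (2 * a * 0))"
        by (simp add: DERIV_deriv_iff_field_differentiable)
      moreover have "((\<lambda>u. 2 * a * u) has_field_derivative 2 * a) (at 0)"
        by (auto intro!: derivative_eq_intros)
      ultimately show ?thesis
        unfolding k_def by (rule DERIV_chain2)
    qed
    ultimately show False
      using a by (simp add: DERIV_imp_deriv norm_mult mult.commute flip: mult.assoc)
  qed
  then obtain w where "w \<notin> f ` ball 0 1" "cmod w \<le> 2 * cmod a"
    by blast
  moreover from this have "w \<noteq> 0"
    using f0 by force
  ultimately show ?thesis
    using that by (simp add: a_def)
qed

text \<open>If \<open>f\<close> omits \<open>w\<close>, the square root \<open>s\<close> of \<open>1 - f / w\<close> with \<open>s 0 = 1\<close> omits \<open>0\<close> and \<open>-1\<close>, the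
  latter because \<open>f\<close> vanishes only at \<open>0\<close>. Schottky's theorem then replaces the Koebe
  distortion theorem.\<close>

lemma univalent_growth:
  obtains K where "K > 0" and
    "\<And>f u. \<lbrakk>f holomorphic_on ball 0 1; inj_on f (ball 0 1); f 0 = 0; cmod u \<le> 1/2\<rbrakk>
       \<Longrightarrow> cmod (f u) \<le> K * cmod (deriv f 0)"
proof
  \<comment> \<open>Schottky's bound on |z| <= 2/3 for functions of modulus at most 1 at the
    origin.\<close>
  define E :: real where "E = exp (pi * exp (pi * (2 + 2 * 1 + 12 * (2/3) / (1 - 2/3))))"
  show "2 * (1 + E\<^sup>2) > 0"
    by (smt (verit) zero_le_power2)
  fix f u
  assume f: "f holomorphic_on ball 0 1" and inj: "inj_on f (ball 0 1)" and f0: "f 0 = 0"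
    and u: "cmod u \<le> 1/2"
  obtain w where w: "w \<notin> f ` ball 0 1" "w \<noteq> 0" "cmod w \<le> 2 * cmod (deriv f 0)"
    by (rule univalent_omits_value[OF f inj f0])
  have "(\<lambda>z. 1 - f z / w) holomorphic_on ball 0 1"
    using w by (intro holomorphic_intros f) auto
  moreover have "1 - f z / w \<noteq> 0" if "z \<in> ball 0 1" for z
    using w that by auto
  ultimately obtain L where L: "L holomorphic_on ball 0 1"
    and eL: "\<And>z. z \<in> ball 0 1 \<Longrightarrow> exp (L z) = 1 - f z / w"
    by (rule holomorphic_logarithm_exists[OF convex_ball open_ball, of "\<lambda>z. 1 - f z / w" 0 1 0])
      (use that in auto)
  define s where "s z = exp ((L z - L 0) / 2)" for z
  have s2: "(s z)\<^sup>2 = 1 - f z / w" if "z \<in> ball 0 1" for z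
  proof -
    have "(s z)\<^sup>2 = exp (L z - L 0)"
      unfolding s_def by (simp add: power2_eq_square flip: exp_add)
    then show ?thesis
      using eL[OF that] eL[of 0] f0 by (simp add: exp_diff)
  qed
  have sm1: "s z \<noteq> -1" if "z \<in> ball 0 1" for z
  proof
    assume "s z = -1"
    then have "f z = f 0"
      using s2[OF that] w f0 by (simp add: power2_eq_square)
    then have "z = 0"
      using inj that by (auto dest: inj_onD)
    then show False
      using \<open>s z = -1\<close> by (simp add: s_def)
  qed
  \<comment> \<open>Schottky's theorem needs the closed disc, hence the factor 3/4, which turns |u|
    <= 1/2 into |4u/3| <= 2/3. The sign turns the omitted value -1 into 1.\<close>
  have "cmod (- s ((3/4) * ((4/3) * u))) \<le> E"
    unfolding E_def
  proof (rule Schottky[where f = "\<lambda>z. - s ((3/4) * z)"])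
    show "(\<lambda>z. - s (3 / 4 * z)) holomorphic_on cball 0 1"
      unfolding s_def
      by (intro holomorphic_intros holomorphic_on_compose_gen[of "\<lambda>z. 3 / 4 * z" _ L, unfolded o_def, OF _ L])
         (auto simp: norm_mult)
    show "cmod (- s (3 / 4 * 0)) \<le> 1"
      by (simp add: s_def)
    show "\<not> (- s (3 / 4 * z) = 0 \<or> - s (3 / 4 * z) = 1)" if "z \<in> cball 0 1" for z
      using that sm1[of "3/4 * z"] by (auto simp: s_def norm_mult minus_equation_iff)
  qed (use u in \<open>auto simp: norm_mult\<close>)
  then have "(cmod (s u))\<^sup>2 \<le> E\<^sup>2"
    by (intro power_mono) auto
  moreover have "f u = w * (1 - (s u)\<^sup>2)"
    using s2[of u] u w by (simp add: field_simps)
  then have "cmod (f u) \<le> cmod w * (1 + (cmod (s u))\<^sup>2)"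
    by (metis norm_mult norm_one norm_power norm_triangle_ineq4 mult_left_mono norm_ge_zero)
  ultimately have "cmod (f u) \<le> cmod w * (1 + E\<^sup>2)"
    by (smt (verit) mult_left_mono norm_ge_zero)
  also have "\<dots> \<le> 2 * cmod (deriv f 0) * (1 + E\<^sup>2)"
    using w by (intro mult_right_mono) auto
  finally show "cmod (f u) \<le> 2 * (1 + E\<^sup>2) * cmod (deriv f 0)"
    by (simp add: algebra_simps)
qed

text \<open>Cauchy's inequality on discs of radius 1/4 bounds the second derivative on |x| <= 1/4 by
  2! * 4^2 * K |f'(0)|, which is the source of the 32 below; Taylor's formula does the rest.\<close>

lemma univalent_near_linear_unit:
  obtains C where "C > 0" and
    "\<And>f u. \<lbrakk>f holomorphic_on ball 0 1; inj_on f (ball 0 1); f 0 = 0; cmod u \<le> 1/4\<rbrakk>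
       \<Longrightarrow> cmod (f u - deriv f 0 * u) \<le> C * cmod (deriv f 0) * (cmod u)\<^sup>2"
proof -
  obtain K where K: "K > 0" and
    g: "\<And>f u. \<lbrakk>f holomorphic_on ball 0 1; inj_on f (ball 0 1); f 0 = 0; cmod u \<le> 1/2\<rbrakk>
       \<Longrightarrow> cmod (f u) \<le> K * cmod (deriv f 0)"
    using univalent_growth by blast
  show ?thesis
  proof
    show "32 * K > 0" using K by simp
    fix f u
    assume f: "f holomorphic_on ball 0 1" and inj: "inj_on f (ball 0 1)" and f0: "f 0 = 0"
      and u: "cmod u \<le> 1/4"
    have fh: "(deriv ^^ i) f holomorphic_on ball 0 1" for i
      using f by (intro holomorphic_higher_deriv) auto
    have "cmod ((deriv ^^ 0) f u - (\<Sum>i\<le>1. (deriv ^^ i) f 0 * (u - 0) ^ i / fact i))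
        \<le> (32 * K * cmod (deriv f 0)) * cmod (u - 0) ^ Suc 1 / fact 1"
    proof (rule complex_Taylor[where S = "cball 0 (1/4)"])
      show "((deriv ^^ i) f has_field_derivative (deriv ^^ Suc i) f x) (at x within cball 0 (1/4))"
        if "x \<in> cball 0 (1/4)" for i x
        using holomorphic_derivI[OF fh[of i] open_ball, of x] that
        by (auto intro: DERIV_subset)
      show "cmod ((deriv ^^ Suc 1) f x) \<le> 32 * K * cmod (deriv f 0)"
        if x: "x \<in> cball 0 (1/4)" for x
      proof -
        have sub: "cball x (1/4) \<subseteq> cball 0 (1/2)" 
          using x by (auto simp: cball_subset_cball_iff dist_norm)
        have sub1: "cball x (1/4) \<subseteq> ball 0 1"
          using sub by force
        have "cmod ((deriv ^^ 2) f x) \<le> fact 2 * (K * cmod (deriv f 0)) / (1/4)^2"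
        proof (rule Cauchy_inequality)
          show "f holomorphic_on ball x (1/4)"
            using f sub1 ball_subset_cball by (blast intro: holomorphic_on_subset)
          show "continuous_on (cball x (1/4)) f"
            using f sub1 by (blast intro: holomorphic_on_imp_continuous_on holomorphic_on_subset)
          show "cmod (f y) \<le> K * cmod (deriv f 0)" if "cmod (x - y) = 1/4" for y
          proof -
            have "y \<in> cball x (1/4)"
              using that by (auto simp: dist_norm)
            then have "cmod y \<le> 1/2"
              using sub by auto
            then show ?thesis by (rule g[OF f inj f0])
          qed
        qed auto
        then show ?thesis
          by (simp add: numeral_2_eq_2 power2_eq_square)
      qed
    qed (use u in auto)
    then show "cmod (f u - deriv f 0 * u) \<le> 32 * K * cmod (deriv f 0) * (cmod u)\<^sup>2"
      using f0 by (simp add: power2_eq_square)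
  qed
qed

text \<open>Rescaling to the unit disc. The factor 1/r is the point: at a fixed \<open>u\<close> the
  error vanishes relative to the derivative as the disc of univalence grows.\<close>

lemma univalent_near_linear:
  obtains C where "C > 0" and
    "\<And>f r u. \<lbrakk>r > 0; f holomorphic_on ball 0 r; inj_on f (ball 0 r); f 0 = 0; cmod u \<le> r/4\<rbrakk>
       \<Longrightarrow> cmod (f u - deriv f 0 * u) \<le> C * cmod (deriv f 0) * (cmod u)\<^sup>2 / r"
proof -
  obtain C where C: "C > 0" and
    g: "\<And>f u. \<lbrakk>f holomorphic_on ball 0 1; inj_on f (ball 0 1); f 0 = 0; cmod u \<le> 1/4\<rbrakk>
       \<Longrightarrow> cmod (f u - deriv f 0 * u) \<le> C * cmod (deriv f 0) * (cmod u)\<^sup>2"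
    using univalent_near_linear_unit by blast
  show ?thesis
  proof
    fix f r u
    assume r: "r > 0" and f: "f holomorphic_on ball 0 r" and inj: "inj_on f (ball 0 r)"
      and f0: "f 0 = 0" and u: "cmod u \<le> r/4"
    define k where "k v = f (of_real r * v)" for v
    have sub: "of_real r * v \<in> ball 0 r" if "v \<in> ball 0 1" for v :: complex
      using that r mult_strict_left_mono[of "cmod v" 1 r] by (simp add: norm_mult)
    have "(k has_field_derivative deriv f 0 * of_real r) (at 0)"
    proof -
      have "(f has_field_derivative deriv f 0) (at (of_real r * 0))"
        using f r by (auto intro!: holomorphic_derivI)
      moreover have "((\<lambda>v. of_real r * v) has_field_derivative of_real r) (at 0)"
        by (auto intro!: derivative_eq_intros)
      ultimately show ?thesis
        unfolding k_def by (rule DERIV_chain2)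
    qed
    then have dk: "deriv k 0 = deriv f 0 * of_real r"
      by (rule DERIV_imp_deriv)
    have "cmod (k (u / r) - deriv k 0 * (u / r)) \<le> C * cmod (deriv k 0) * (cmod (u / r))\<^sup>2"
    proof (rule g)
      show "k holomorphic_on ball 0 1"
        unfolding k_def
        by (intro holomorphic_on_compose_gen[of "\<lambda>v. of_real r * v" _ f, unfolded o_def, OF _ f]
            holomorphic_intros) (use sub in auto)
      show "inj_on k (ball 0 1)"
      proof (rule inj_onI)
        fix x y assume "x \<in> ball 0 1" "y \<in> ball 0 1" "k x = k y"
        then have "of_real r * x = of_real r * y"
          using inj_onD[OF inj _ sub sub] by (simp add: k_def)
        then show "x = y" using r by simp
      qed
      show "cmod (u / r) \<le> 1/4"
        using u r by (simp add: norm_divide field_simps)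
    qed (use f0 in \<open>auto simp: k_def\<close>)
    then show "cmod (f u - deriv f 0 * u) \<le> C * cmod (deriv f 0) * (cmod u)\<^sup>2 / r"
      using r by (simp add: dk k_def norm_mult norm_divide power2_eq_square field_simps)
  qed (fact C)
qed

text \<open>The normalisation \<open>f 1 = 1\<close> pins the derivative \<open>a\<close>: linearity
  at \<open>u = 1\<close> gives |1 - a| <= C |a| / r, hence |a| <= 2 and |1 - a| <= 2 C / r.\<close>

lemma univalent_near_identity:
  obtains C where "C > 0" and
    "\<And>f r u. \<lbrakk>r \<ge> C; f holomorphic_on ball 0 r; inj_on f (ball 0 r); f 0 = 0; f 1 = 1; cmod u \<le> r/4\<rbrakk>
       \<Longrightarrow> cmod (f u - u) \<le> C * ((cmod u)\<^sup>2 + cmod u) / r"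
proof -
  obtain C where C: "C > 0" and
    g: "\<And>f r u. \<lbrakk>r > 0; f holomorphic_on ball 0 r; inj_on f (ball 0 r); f 0 = 0; cmod u \<le> r/4\<rbrakk>
       \<Longrightarrow> cmod (f u - deriv f 0 * u) \<le> C * cmod (deriv f 0) * (cmod u)\<^sup>2 / r"
    using univalent_near_linear by blast
  show ?thesis
  proof
    \<comment> \<open>r >= 4 admits the point \<open>u = 1\<close>, and r >= 2 C gives |1 - a| <=
      |a| / 2.\<close>
    show "2 * C + 4 > 0" using C by simp
    fix f r u
    assume r: "r \<ge> 2 * C + 4" and f: "f holomorphic_on ball 0 r" and inj: "inj_on f (ball 0 r)"
      and f0: "f 0 = 0" and f1: "f 1 = 1" and u: "cmod u \<le> r/4"
    define a where "a = deriv f 0"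
    have r0: "r > 0" "r \<ge> 4" using r C by auto
    have 1: "cmod (1 - a) \<le> C * cmod a / r"
      using g[OF r0(1) f inj f0, of 1] f1 r0 by (simp add: a_def)
    also have "\<dots> \<le> cmod a / 2"
      using r r0 mult_right_mono[of "2*C" r "cmod a"] by (simp add: field_simps)
    finally have "cmod a \<le> 2"
      using norm_triangle_ineq2[of a 1] by (simp add: norm_minus_commute)
    then have a2: "C * cmod a / r \<le> 2 * C / r"
      using C r0 by (intro divide_right_mono) auto
    have "cmod (f u - u) \<le> cmod (f u - a * u) + cmod (1 - a) * cmod u"
      using norm_triangle_ineq4[of "f u - a * u" "(1 - a) * u"]
      by (simp add: algebra_simps norm_mult[symmetric])
    also have "\<dots> \<le> C * cmod a / r * (cmod u)\<^sup>2 + C * cmod a / r * cmod u"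
      using g[OF r0(1) f inj f0 u] 1 by (intro add_mono mult_right_mono) (auto simp: a_def)
    also have "\<dots> \<le> 2 * C / r * (cmod u)\<^sup>2 + 2 * C / r * cmod u"
      by (intro add_mono mult_right_mono a2) auto
    also have "\<dots> = 2 * C * ((cmod u)\<^sup>2 + cmod u) / r"
      by (simp add: algebra_simps add_divide_distrib)
    also have "\<dots> \<le> (2 * C + 4) * ((cmod u)\<^sup>2 + cmod u) / r"
      using r0 by (intro divide_right_mono mult_right_mono) auto
    finally show "cmod (f u - u) \<le> (2 * C + 4) * ((cmod u)\<^sup>2 + cmod u) / r" .
  qed
qed

text \<open>\<open>k = f - f 0\<close> is univalent on every disc about 0, so the radius in
  \<open>univalent_near_linear\<close> can tend to infinity.\<close>

lemma injective_entire_affine: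
  fixes f :: "complex \<Rightarrow> complex"
  assumes f: "f holomorphic_on UNIV" and inj: "inj f"
  obtains a b where "a \<noteq> 0" "\<And>z. f z = a * z + b"
proof -
  define k where "k z = f z - f 0" for z
  have k: "k holomorphic_on UNIV" "inj k"
    using f inj unfolding k_def by (auto intro!: holomorphic_intros simp: inj_def)
  have k0: "k 0 = 0"
    by (simp add: k_def)
  obtain C where C: "C > 0" and
    g: "\<And>f r u. \<lbrakk>r > 0; f holomorphic_on ball 0 r; inj_on f (ball 0 r); f 0 = 0; cmod u \<le> r/4\<rbrakk>
       \<Longrightarrow> cmod (f u - deriv f 0 * u) \<le> C * cmod (deriv f 0) * (cmod u)\<^sup>2 / r"
    using univalent_near_linear by blast
  have lin: "k u = deriv k 0 * u" for u
  proof -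
    have "\<forall>\<^sub>F r in at_top. cmod (k u - deriv k 0 * u) \<le> C * cmod (deriv k 0) * (cmod u)\<^sup>2 / r"
      using eventually_ge_at_top[of "4 * cmod u + 1"]
    proof eventually_elim
      case (elim r)
      then have "r > 0" "cmod u \<le> r / 4"
        using norm_ge_zero[of u] by linarith+
      moreover have "k holomorphic_on ball 0 r" "inj_on k (ball 0 r)"
        using k by (auto intro: holomorphic_on_subset inj_on_subset)
      ultimately show ?case
        by (intro g) (simp_all add: k0)
    qed
    moreover have "((\<lambda>r. C * cmod (deriv k 0) * (cmod u)\<^sup>2 / r) \<longlongrightarrow> 0) at_top"
      by (intro tendsto_divide_0[OF tendsto_const] filterlim_at_top_imp_at_infinity filterlim_ident)
    ultimately have "cmod (k u - deriv k 0 * u) \<le> 0"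
      using tendsto_lowerbound[of _ 0 at_top] trivial_limit_at_top_linorder by blast
    then show ?thesis by simp
  qed
  have "deriv k 0 \<noteq> 0"
    using lin[of 0] lin[of 1] injD[OF k(2), of 0 1] by auto
  moreover have "f z = deriv k 0 * z + f 0" for z
    using lin[of z] by (simp add: k_def algebra_simps)
  ultimately show ?thesis using that by blast
qed

text \<open>A preimage of \<open>w\<close> is a Brouwer fixed point of \<open>u - f u + w\<close>.
  This map sends the closed disc into the open one, so the fixed point is interior.\<close>

lemma ball_subset_image_near_identity:
  fixes f :: "complex \<Rightarrow> complex"
  assumes "continuous_on (cball 0 r) f" and "\<And>u. cmod u \<le> r \<Longrightarrow> cmod (f u - u) < 1"
  shows "ball 0 (r - 1) \<subseteq> f ` ball 0 r"
proof
  fix w :: complex assume "w \<in> ball 0 (r - 1)"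
  then have w: "cmod w < r - 1" by simp
  then have r: "r > 0" using norm_ge_zero[of w] by linarith
  have *: "cmod (u - f u + w) < r" if "cmod u \<le> r" for u
    using norm_triangle_ineq[of "u - f u" w] assms(2)[OF that] w by (simp add: norm_minus_commute)
  obtain u where "u \<in> cball 0 r" "u - f u + w = u"
    by (rule brouwer_ball[of r 0 "\<lambda>u. u - f u + w"])
      (use r * in \<open>auto intro!: continuous_intros assms(1) less_imp_le\<close>)
  then have "f u = w" "cmod u < r"
    using *[of u] by auto
  then show "w \<in> f ` ball 0 r" by force
qed

subsection \<open>Dynamics of zero-step maps\<close>

locale zero_step =
  fixes \<phi> :: "complex \<Rightarrow> complex" and z0 :: complex and h :: "complex \<Rightarrow> complex"
  assumes phi_holo: "\<phi> holomorphic_on uhp"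
    and phi_Im: "\<And>z. z \<in> uhp \<Longrightarrow> Im z < Im (\<phi> z)"
    and zero_step: "\<exists>z\<in>uhp. (\<lambda>n. hyp_dist ((\<phi> ^^ n) z) ((\<phi> ^^ Suc n) z)) \<longlonglongrightarrow> 0"
    and z0: "z0 \<in> uhp"
    and BP: "BP_semiconj \<phi> z0 h"
begin

definition p where "p z = \<phi> z - z"
definition orb where "orb n = (\<phi> ^^ n) z0"
definition step where "step n = orb (Suc n) - orb n"

lemma phi_uhp: "z \<in> uhp \<Longrightarrow> \<phi> z \<in> uhp"
  using phi_Im[of z] by (simp add: uhp_def)

lemma iter_uhp: "z \<in> uhp \<Longrightarrow> (\<phi> ^^ n) z \<in> uhp"
  by (induction n) (auto intro: phi_uhp)

lemma iter_holo: "(\<phi> ^^ n) holomorphic_on uhp"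
proof (induction n)
  case (Suc n)
  have "(\<phi> \<circ> (\<phi> ^^ n)) holomorphic_on uhp"
    by (rule holomorphic_on_compose_gen[OF Suc phi_holo]) (use iter_uhp in auto)
  then show ?case by (simp add: o_def)
qed (simp add: holomorphic_on_id[unfolded id_def] id_def)

lemma p_holo: "p holomorphic_on uhp"
  unfolding p_def by (intro holomorphic_intros phi_holo)

lemma p_uhp: "z \<in> uhp \<Longrightarrow> p z \<in> uhp"
  using phi_Im[of z] by (simp add: p_def uhp_def)

lemma orb_uhp: "orb n \<in> uhp"
  unfolding orb_def by (rule iter_uhp[OF z0])

lemma Im_orb_pos: "Im (orb n) > 0"
  using orb_uhp by (simp add: uhp_def)

lemma step_eq_p: "step n = p (orb n)"
  by (simp add: step_def p_def orb_def)

lemma step_nonzero: "step n \<noteq> 0"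
  using p_uhp[OF orb_uhp, of n] by (auto simp: step_eq_p uhp_def)

lemma Schwarz_Pick_p:
  "z \<in> uhp \<Longrightarrow> w \<in> uhp \<Longrightarrow> cmod (p z - p w) * cmod (z - cnj w) \<le> cmod (z - w) * cmod (p z - cnj (p w))"
  by (rule Schwarz_Pick_uhp[OF p_holo]) (use p_uhp in auto)

lemma pseudo_hyp_p_le:
  assumes "z \<in> uhp" "w \<in> uhp" "cmod (z - w) \<le> k * cmod (z - cnj w)"
  shows "cmod (p z - p w) \<le> k * cmod (p z - cnj (p w))"
proof -
  have "cmod (z - cnj w) > 0"
    using uhp_minus_cnj_nonzero[OF assms(1,2)] by simp
  moreover have "cmod (p z - p w) * cmod (z - cnj w) \<le> (k * cmod (p z - cnj (p w))) * cmod (z - cnj w)"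
    using Schwarz_Pick_p[OF assms(1,2)] mult_right_mono[OF assms(3), of "cmod (p z - cnj (p w))"]
    by (simp add: mult_ac)
  ultimately show ?thesis
    by (rule mult_right_le_imp_le[rotated])
qed

lemma pseudo_hyp_iter_le:
  assumes "z \<in> uhp" "w \<in> uhp" "cmod (z - w) \<le> k * cmod (z - cnj w)"
  shows "cmod ((\<phi> ^^ n) z - (\<phi> ^^ n) w) \<le> k * cmod ((\<phi> ^^ n) z - cnj ((\<phi> ^^ n) w))"
proof -
  have "cmod (z - cnj w) > 0"
    using uhp_minus_cnj_nonzero[OF assms(1,2)] by simp
  moreover have "cmod ((\<phi> ^^ n) z - (\<phi> ^^ n) w) * cmod (z - cnj w)
      \<le> (k * cmod ((\<phi> ^^ n) z - cnj ((\<phi> ^^ n) w))) * cmod (z - cnj w)"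
    using Schwarz_Pick_uhp[OF iter_holo[of n] _ assms(1,2)] iter_uhp[of _ n]
      mult_right_mono[OF assms(3), of "cmod ((\<phi> ^^ n) z - cnj ((\<phi> ^^ n) w))"]
    by (force simp: mult_ac)
  ultimately show ?thesis
    by (rule mult_right_le_imp_le[rotated])
qed

text \<open>Schwarz--Pick for \<open>\<phi> ^^ n\<close> and for \<open>p\<close> transfers the zero-step property between orbits.\<close>

lemma step_ratio_tendsto_0: "(\<lambda>n. cmod (step n) / Im (orb n)) \<longlonglongrightarrow> 0"
proof -
  obtain w where w: "w \<in> uhp"
    and lim: "(\<lambda>n. hyp_dist ((\<phi> ^^ n) w) ((\<phi> ^^ Suc n) w)) \<longlonglongrightarrow> 0"
    using zero_step by blast
  define v where "v n = (\<phi> ^^ n) w" for n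
  define s where "s n = cmod (v n - v (Suc n)) / cmod (v n - cnj (v (Suc n)))" for n
  have v: "v n \<in> uhp" for n
    unfolding v_def by (rule iter_uhp[OF w])
  then have Imv: "Im (v n) > 0" for n
    by (auto simp: uhp_def)
  have pv: "p (v n) = v (Suc n) - v n" for n
    by (simp add: p_def v_def)
  have s0: "s \<longlonglongrightarrow> 0"
  proof (rule tendsto_sandwich[OF _ _ tendsto_const lim])
    show "\<forall>\<^sub>F n in sequentially. s n \<le> hyp_dist ((\<phi> ^^ n) w) ((\<phi> ^^ Suc n) w)"
      using pseudo_hyp_le_hyp_dist[OF v v] unfolding s_def v_def by (intro always_eventually allI)
  qed (auto simp: s_def)
  \<comment> \<open>Passage to Euclidean size: |v n - cnj (v (Suc n))| <= |p (v n)| + 2 Im (v n),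
    and s n <= 1/2 lets the first term be absorbed on the left.\<close>
  have q: "cmod (p (v n)) / Im (v n) \<le> 4 * s n" if "s n \<le> 1/2" for n
  proof -
    have c: "cmod (v n - cnj (v (Suc n))) > 0"
      using uhp_minus_cnj_nonzero[OF v v] by simp
    have "cmod (p (v n)) = s n * cmod (v n - cnj (v (Suc n)))"
      using c by (simp add: s_def pv norm_minus_commute)
    also have "\<dots> \<le> s n * (cmod (p (v n)) + 2 * Im (v n))"
      using cmod_diff_cnj_le[of "v n" "v (Suc n)"] Imv[of n]
      by (intro mult_left_mono) (auto simp: s_def pv cmod_diff_cnj_commute[of "v n"])
    also have "\<dots> \<le> cmod (p (v n)) / 2 + s n * (2 * Im (v n))"
      using mult_right_mono[OF that, of "cmod (p (v n))"] by (simp add: algebra_simps)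
    finally show ?thesis
      using Imv[of n] by (simp add: field_simps)
  qed
  \<comment> \<open>The pseudo-hyperbolic distance of the starting points bounds that of all later
    pairs. Numerator and denominator of the ratio each cost one factor \<open>K\<close>.\<close>
  define k where "k = cmod (z0 - w) / cmod (z0 - cnj w)"
  define K where "K = (1 + k) / (1 - k)"
  have k: "0 \<le> k" "k < 1"
    using cmod_cayley_less_1[OF z0 w] by (auto simp: k_def norm_divide)
  have K: "K > 0" using k by (simp add: K_def)
  have z0w: "cmod (z0 - w) \<le> k * cmod (z0 - cnj w)"
    using uhp_minus_cnj_nonzero[OF z0 w] by (simp add: k_def)
  have ov: "cmod (orb n - v n) \<le> k * cmod (orb n - cnj (v n))" for n
    unfolding orb_def v_def by (rule pseudo_hyp_iter_le[OF z0 w z0w])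
  have cmp: "cmod (step n) / Im (orb n) \<le> K\<^sup>2 * (cmod (p (v n)) / Im (v n))" for n
  proof -
    have 1: "cmod (step n) \<le> K * cmod (p (v n))"
      unfolding step_eq_p K_def
      by (intro cmod_le_of_pseudo_hyp k pseudo_hyp_p_le orb_uhp v ov)
    have 2: "Im (v n) \<le> K * Im (orb n)"
      unfolding K_def using ov[of n] Im_orb_pos[of n]
      by (intro Im_le_of_pseudo_hyp k) (simp_all add: cmod_diff_cnj_commute[of "v n"] norm_minus_commute)
    have "cmod (step n) * Im (v n) \<le> (K * cmod (p (v n))) * (K * Im (orb n))"
      using 1 2 K Imv[of n] by (intro mult_mono) auto
    then show ?thesis
      using Imv[of n] Im_orb_pos[of n] by (simp add: field_simps power2_eq_square)
  qed
  have "(\<lambda>n. K\<^sup>2 * (4 * s n)) \<longlonglongrightarrow> K\<^sup>2 * (4 * 0)"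
    by (intro tendsto_intros s0)
  then have lim0: "(\<lambda>n. K\<^sup>2 * (4 * s n)) \<longlonglongrightarrow> 0" by simp
  show ?thesis
  proof (rule tendsto_sandwich[OF _ _ tendsto_const lim0])
    have "\<forall>\<^sub>F n in sequentially. s n < 1/2"
      using s0 by (rule order_tendstoD) simp
    then show "\<forall>\<^sub>F n in sequentially. cmod (step n) / Im (orb n) \<le> K\<^sup>2 * (4 * s n)"
    proof eventually_elim
      case (elim n)
      then have "K\<^sup>2 * (cmod (p (v n)) / Im (v n)) \<le> K\<^sup>2 * (4 * s n)"
        by (intro mult_left_mono q) auto
      then show ?case using cmp[of n] by linarith
    qed
  qed (use Im_orb_pos in \<open>auto intro!: always_eventually divide_nonneg_pos\<close>)
qed

text \<open>Schwarz--Pick for \<open>p\<close> at two consecutive orbit points: their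
  pseudo-hyperbolic distance is at most |step n| / Im (orb n), so consecutive steps are equally
  close and their quotient tends to 1.\<close>

lemma step_quotient_tendsto_1: "(\<lambda>n. step (Suc n) / step n) \<longlonglongrightarrow> 1"
proof -
  let ?q = "\<lambda>n. cmod (step n) / Im (orb n)"
  have "(\<lambda>n. step (Suc n) / step n - 1) \<longlonglongrightarrow> 0"
  proof (rule Lim_null_comparison)
    show "(\<lambda>n. 4 * ?q n) \<longlonglongrightarrow> 0"
      using tendsto_mult_right_zero[OF step_ratio_tendsto_0] .
    have "\<forall>\<^sub>F n in sequentially. ?q n < 1/2"
      using step_ratio_tendsto_0 by (rule order_tendstoD) simp
    then show "\<forall>\<^sub>F n in sequentially. cmod (step (Suc n) / step n - 1) \<le> 4 * ?q n"
    proof eventually_elim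
      case (elim n)
      define q where "q = ?q n"
      have q: "0 \<le> q" "q < 1/2"
        using elim Im_orb_pos[of n] by (auto simp: q_def)
      have "cmod (orb (Suc n) - orb n) = q * Im (orb n)"
        using Im_orb_pos[of n] by (simp add: q_def step_def)
      also have "\<dots> \<le> q * cmod (orb (Suc n) - cnj (orb n))"
        using Im_add_le_cmod_diff_cnj[of "orb (Suc n)" "orb n"] Im_orb_pos[of "Suc n"] q
        by (intro mult_left_mono) auto
      finally have ps: "cmod (step (Suc n) - step n) \<le> q * cmod (step (Suc n) - cnj (step n))"
        unfolding step_eq_p by (intro pseudo_hyp_p_le orb_uhp)
      then have "cmod (step (Suc n)) \<le> (1 + q) / (1 - q) * cmod (step n)"
        using q by (intro cmod_le_of_pseudo_hyp) auto
      also have "\<dots> \<le> 3 * cmod (step n)"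
        using q by (intro mult_right_mono) (auto simp: field_simps)
      finally have "cmod (step (Suc n) - cnj (step n)) \<le> 4 * cmod (step n)"
        using norm_triangle_ineq4[of "step (Suc n)" "cnj (step n)"] by simp
      then have "cmod (step (Suc n) - step n) \<le> q * (4 * cmod (step n))"
        using ps q(1) mult_left_mono order_trans by blast
      moreover have "step (Suc n) / step n - 1 = (step (Suc n) - step n) / step n"
        using step_nonzero by (simp add: field_simps)
      ultimately show ?case
        using step_nonzero[of n] by (simp add: norm_divide q_def[symmetric] field_simps)
    qed
  qed
  then show ?thesis
    by (simp add: LIM_zero_iff)
qed

section \<open>Abel's equation for the Baker--Pommerenke limit\<close>

lemma BP_uniform:
  "compact K \<Longrightarrow> K \<subseteq> uhp \<Longrightarrow> uniform_limit K (\<lambda>n z. ((\<phi> ^^ n) z - orb n) / step n) h sequentially"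
  using BP by (simp add: BP_semiconj_def BP_mu_def orb_def step_def o_def)

lemma BP_holo: "(\<lambda>z. ((\<phi> ^^ n) z - orb n) / step n) holomorphic_on uhp"
  by (intro holomorphic_intros iter_holo step_nonzero)

lemma h_holo: "h holomorphic_on uhp"
proof (rule holomorphic_uniform_sequence[OF uhp_open BP_holo])
  fix z assume "z \<in> uhp"
  then obtain e where e: "e > 0" "cball z e \<subseteq> uhp"
    using uhp_open open_contains_cball by blast
  then show "\<exists>d>0. cball z d \<subseteq> uhp \<and>
      uniform_limit (cball z d) (\<lambda>n z. ((\<phi> ^^ n) z - orb n) / step n) h sequentially"
    by (intro exI[of _ e] conjI BP_uniform e compact_cball)
qed

lemma h_lim: "z \<in> uhp \<Longrightarrow> (\<lambda>n. ((\<phi> ^^ n) z - orb n) / step n) \<longlonglongrightarrow> h z"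
  using BP_uniform[of "{z}"] by (auto dest: tendsto_uniform_limitI)

text \<open>The normalisations at \<open>n\<close> and \<open>n + 1\<close> differ by an affine map
  with slope \<open>step (Suc n) / step n\<close>, which tends to 1, and with translation part
  1.\<close>

lemma h_phi:
  assumes z: "z \<in> uhp"
  shows "h (\<phi> z) = h z + 1"
proof -
  have "(\<lambda>n. ((\<phi> ^^ Suc n) z - orb (Suc n)) / step (Suc n) * (step (Suc n) / step n) + 1)
      \<longlonglongrightarrow> h z * 1 + 1"
    by (intro tendsto_intros step_quotient_tendsto_1 LIMSEQ_Suc[OF h_lim[OF z]])
  moreover have "((\<phi> ^^ Suc n) z - orb (Suc n)) / step (Suc n) * (step (Suc n) / step n) + 1
      = ((\<phi> ^^ n) (\<phi> z) - orb n) / step n" for n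
    using step_nonzero[of n] step_nonzero[of "Suc n"] unfolding funpow_Suc_right
    by (simp add: divide_simps) (simp add: step_def)
  ultimately have "(\<lambda>n. ((\<phi> ^^ n) (\<phi> z) - orb n) / step n) \<longlonglongrightarrow> h z + 1"
    by simp
  then show ?thesis
    using h_lim[OF phi_uhp[OF z]] LIMSEQ_unique by blast
qed

lemma h_iter: "z \<in> uhp \<Longrightarrow> h ((\<phi> ^^ n) z) = h z + of_nat n"
  by (induction n) (simp_all add: h_phi iter_uhp)

lemma h_orb: "h (orb n) = of_nat n"
proof -
  have "h z0 = 0"
    using h_lim[OF z0] LIMSEQ_unique[OF _ tendsto_const] by (auto simp: orb_def)
  then show ?thesis
    using h_iter[OF z0] by (simp add: orb_def)
qed

text \<open>The points that \<open>\<phi>\<close> moves by a pseudo-hyperbolic distance below 1/3.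
  The bound 1/3 is what yields |p z| < Im z.\<close>

definition V where "V = {z \<in> uhp. 3 * cmod (\<phi> z - z) < cmod (\<phi> z - cnj z)}"

lemma V_uhp: "z \<in> V \<Longrightarrow> z \<in> uhp"
  by (simp add: V_def)

text \<open>Schwarz--Pick for \<open>\<phi>\<close> at the pair \<open>\<phi> z\<close>,
  \<open>z\<close>: the displacement does not increase along orbits.\<close>

lemma phi_V:
  assumes "z \<in> V"
  shows "\<phi> z \<in> V"
proof -
  have z: "z \<in> uhp" and lt: "3 * cmod (\<phi> z - z) < cmod (\<phi> z - cnj z)"
    using assms by (auto simp: V_def)
  have pos: "cmod (\<phi> (\<phi> z) - cnj (\<phi> z)) > 0"
    using uhp_minus_cnj_nonzero phi_uhp z by simp
  have "3 * cmod (\<phi> (\<phi> z) - \<phi> z) * cmod (\<phi> z - cnj z)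
      \<le> 3 * cmod (\<phi> z - z) * cmod (\<phi> (\<phi> z) - cnj (\<phi> z))"
    using Schwarz_Pick_uhp[OF phi_holo _ phi_uhp[OF z] z] phi_uhp by force
  also have "\<dots> < cmod (\<phi> (\<phi> z) - cnj (\<phi> z)) * cmod (\<phi> z - cnj z)"
    using mult_strict_right_mono[OF lt pos] by (simp add: mult.commute)
  finally have "3 * cmod (\<phi> (\<phi> z) - \<phi> z) < cmod (\<phi> (\<phi> z) - cnj (\<phi> z))"
    by (rule mult_right_less_imp_less) simp
  then show ?thesis
    using phi_uhp[OF z] by (simp add: V_def)
qed

lemma iter_V: "z \<in> V \<Longrightarrow> (\<phi> ^^ n) z \<in> V"
  by (induction n) (auto intro: phi_V)

text \<open>If \<open>\<phi> z = \<phi> w\<close>, then \<open>|z - w| = |p z - p w|\<close>, and this factor cancels in the Schwarz--Pick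
  inequality for \<open>p\<close>.\<close>

lemma inj_phi_V: "inj_on \<phi> V"
proof (rule inj_onI, rule ccontr)
  fix z w assume zw: "z \<in> V" "w \<in> V" and eq: "\<phi> z = \<phi> w" and ne: "z \<noteq> w"
  have pb: "cmod (p u) < Im u" if "u \<in> V" for u
    using that cmod_diff_cnj_le[of u "\<phi> u"] by (auto simp: V_def p_def uhp_def)
  have "z - w = p w - p z"
    using eq by (simp add: p_def)
  then have "cmod (p z - p w) = cmod (z - w)"
    by (metis norm_minus_commute)
  then have "cmod (z - w) * cmod (z - cnj w) \<le> cmod (z - w) * cmod (p z - cnj (p w))"
    using Schwarz_Pick_p[of z w] zw V_uhp by simp
  then have "cmod (z - cnj w) \<le> cmod (p z - cnj (p w))"
    using ne by simp
  also have "\<dots> \<le> cmod (p z) + cmod (p w)"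
    using norm_triangle_ineq4[of "p z" "cnj (p w)"] by simp
  \<comment> \<open>Im z + Im w <= |z - cnj w| <= |p z| + |p w| < Im z + Im w.\<close>
  finally show False
    using pb[OF zw(1)] pb[OF zw(2)] Im_add_le_cmod_diff_cnj[of z w] by simp
qed

lemma inj_iter_V: "inj_on (\<phi> ^^ n) V"
proof (induction n)
  case (Suc n)
  show ?case
  proof (rule inj_onI)
    fix x y assume xy: "x \<in> V" "y \<in> V" "(\<phi> ^^ Suc n) x = (\<phi> ^^ Suc n) y"
    then have "(\<phi> ^^ n) x = (\<phi> ^^ n) y"
      using inj_onD[OF inj_phi_V _ iter_V iter_V] by simp
    then show "x = y"
      using inj_onD[OF Suc] xy by blast
  qed
qed simp

text \<open>A radius proportional to the height keeps \<open>B n\<close> of fixed hyperbolic size,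
  while by \<open>step_ratio_tendsto_0\<close> it becomes arbitrarily large in units of |step
  n|.\<close>

definition B where "B n = ball (orb n) (Im (orb n) / 2)"

lemma B_uhp: "B n \<subseteq> uhp"
proof
  fix z assume "z \<in> B n"
  then show "z \<in> uhp"
    using abs_Im_le_cmod[of "orb n - z"] Im_orb_pos[of n] by (simp add: B_def uhp_def dist_norm)
qed

lemma eventually_small_step: "\<forall>\<^sub>F n in sequentially. 8 * cmod (step n) < Im (orb n)"
proof -
  have "\<forall>\<^sub>F n in sequentially. cmod (step n) / Im (orb n) < 1/8"
    using step_ratio_tendsto_0 by (rule order_tendstoD) simp
  then show ?thesis
    by eventually_elim (use Im_orb_pos in \<open>simp add: field_simps\<close>)
qed

text \<open>Points of \<open>B n\<close> are within pseudo-hyperbolic distance 1/3 of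
  \<open>orb n\<close>, so |p z| <= 2 |step n| by Schwarz--Pick for \<open>p\<close>, whereas
  |\<phi> z - cnj z| exceeds Im (orb n).\<close>

lemma B_subset_V:
  assumes n: "8 * cmod (step n) < Im (orb n)"
  shows "B n \<subseteq> V"
proof
  fix z assume z: "z \<in> B n"
  then have zu: "z \<in> uhp" using B_uhp by blast
  have d: "cmod (z - orb n) < Im (orb n) / 2"
    using z by (simp add: B_def dist_norm norm_minus_commute)
  then have Imz: "Im z > Im (orb n) / 2"
    using abs_Im_le_cmod[of "z - orb n"] by simp
  have "cmod (z - orb n) \<le> 1/3 * cmod (z - cnj (orb n))"
    using d Imz Im_add_le_cmod_diff_cnj[of z "orb n"] by simp
  then have "cmod (p z - p (orb n)) \<le> 1/3 * cmod (p z - cnj (p (orb n)))"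
    by (intro pseudo_hyp_p_le zu orb_uhp)
  then have "cmod (p z) \<le> (1 + 1/3) / (1 - 1/3) * cmod (p (orb n))"
    by (intro cmod_le_of_pseudo_hyp) auto
  then have "cmod (p z) \<le> 2 * cmod (step n)"
    by (simp add: step_eq_p)
  then have "4 * cmod (p z) < Im (orb n)"
    using n by linarith
  then show "z \<in> V"
    using zu Imz Im_add_le_cmod_diff_cnj[of "\<phi> z" z] phi_Im[OF zu] Im_orb_pos[of n]
    by (simp add: V_def p_def)
qed

text \<open>Hurwitz's theorem for the normalised iterates, which are injective on \<open>B n\<close>
  inside \<open>V\<close>. The limit is not constant because \<open>B n\<close> contains
  \<open>orb n\<close> and \<open>orb (Suc n)\<close>, where \<open>h\<close> takes the values
  \<open>n\<close> and \<open>n + 1\<close>.\<close>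

lemma h_inj_B:
  assumes n: "8 * cmod (step n) < Im (orb n)"
  shows "inj_on h (B n)"
proof (rule Hurwitz_injective[where \<F> = "\<lambda>n z. ((\<phi> ^^ n) z - orb n) / step n"])
  show "open (B n)" "connected (B n)"
    by (auto simp: B_def)
  show "(\<lambda>z. ((\<phi> ^^ m) z - orb m) / step m) holomorphic_on B n" for m
    using BP_holo B_uhp by (rule holomorphic_on_subset)
  show "h holomorphic_on B n"
    using h_holo B_uhp by (rule holomorphic_on_subset)
  show "uniform_limit K (\<lambda>n z. ((\<phi> ^^ n) z - orb n) / step n) h sequentially"
    if "compact K" "K \<subseteq> B n" for K
    using that B_uhp by (intro BP_uniform) auto
  show "inj_on (\<lambda>z. ((\<phi> ^^ m) z - orb m) / step m) (B n)" for m
    using inj_on_subset[OF inj_iter_V B_subset_V[OF n], of m] step_nonzero[of m]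
    by (auto simp: inj_on_def)
  show "\<not> h constant_on B n"
  proof
    assume "h constant_on B n"
    moreover have "orb n \<in> B n" "orb (Suc n) \<in> B n"
      using n Im_orb_pos[of n] by (auto simp: B_def dist_norm step_def norm_minus_commute)
    ultimately show False
      using h_orb[of n] h_orb[of "Suc n"] unfolding constant_on_def by force
  qed
qed

section \<open>Asymptotics of \<open>h\<close> along the orbit\<close>

definition chart where "chart n u = orb n + step n * u"

text \<open>In the coordinate \<open>u\<close> given by \<open>z = z\<^sub>n + (z\<^sub>n\<^sub>+\<^sub>1 - z\<^sub>n) u\<close> the map \<open>h - n\<close> is univalent on a disc whose
  radius tends to infinity and fixes \<open>0\<close> and \<open>1\<close>, so it converges to the identity.\<close>

lemma eventually_chart:
  "\<forall>\<^sub>F n in sequentially. chart n ` cball 0 r \<subseteq> B n \<and> B n \<subseteq> V \<and> inj_on h (B n) \<and>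
     ball (of_nat n) (r - 1) \<subseteq> h ` chart n ` ball 0 r"
proof -
  obtain C where C: "C > 0" and
    near: "\<And>f r u. \<lbrakk>r \<ge> C; f holomorphic_on ball 0 r; inj_on f (ball 0 r); f 0 = 0; f 1 = 1; cmod u \<le> r/4\<rbrakk>
       \<Longrightarrow> cmod (f u - u) \<le> C * ((cmod u)\<^sup>2 + cmod u) / r"
    using univalent_near_identity by blast
  \<comment> \<open>The radius of \<open>B n\<close> in the coordinate \<open>u\<close>.\<close>
  define \<rho> where "\<rho> n = Im (orb n) / (2 * cmod (step n))" for n
  \<comment> \<open>The entries secure, in order, positivity, the lower bound on the radius in
    \<open>near\<close>, |u| <= \<rho> n / 4 whenever |u| <= r, and an error below 1.\<close>
  define R where "R = max 1 (max C (max (4 * r) (C * (r\<^sup>2 + \<bar>r\<bar>) + 1)))"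
  have R: "R > 0" "R \<ge> C" "R \<ge> 4 * r" "R > C * (r\<^sup>2 + \<bar>r\<bar>)"
    by (auto simp: R_def)
  have "\<forall>\<^sub>F n in sequentially. cmod (step n) / Im (orb n) < 1 / (2 * R)"
    using step_ratio_tendsto_0 R by (intro order_tendstoD) auto
  then show ?thesis
    using eventually_small_step
  proof eventually_elim
    case (elim n)
    have \<rho>: "\<rho> n > R"
      using elim(1) R Im_orb_pos[of n] step_nonzero[of n] by (simp add: \<rho>_def field_simps)
    have chartB: "chart n u \<in> B n" if "cmod u < \<rho> n" for u
      using that step_nonzero[of n] by (simp add: chart_def B_def dist_norm norm_mult \<rho>_def field_simps)
    define H where "H u = h (chart n u) - of_nat n" for u
    have chart_holo: "chart n holomorphic_on S" for S
      unfolding chart_def by (intro holomorphic_intros)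
    have Hh: "H holomorphic_on ball 0 (\<rho> n)"
      unfolding H_def
      by (intro holomorphic_intros holomorphic_on_compose_gen[OF chart_holo h_holo, unfolded o_def])
        (auto intro!: subsetD[OF B_uhp chartB])
    have injH: "inj_on H (ball 0 (\<rho> n))"
    proof (rule inj_onI)
      fix x y assume "x \<in> ball 0 (\<rho> n)" "y \<in> ball 0 (\<rho> n)" "H x = H y"
      then have "chart n x = chart n y"
        using inj_onD[OF h_inj_B[OF elim(2)] _ chartB chartB] by (simp add: H_def)
      then show "x = y"
        using step_nonzero[of n] by (simp add: chart_def)
    qed
    have H01: "H 0 = 0" "H 1 = 1"
      using h_orb[of n] h_orb[of "Suc n"] by (auto simp: H_def chart_def step_def)
    have close: "cmod (H u - u) < 1" if u: "cmod u \<le> r" for u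
    proof -
      have "cmod (H u - u) \<le> C * ((cmod u)\<^sup>2 + cmod u) / \<rho> n"
        using \<rho> R u by (intro near[OF _ Hh injH H01]) auto
      also have "\<dots> \<le> C * (r\<^sup>2 + \<bar>r\<bar>) / \<rho> n"
        using C u \<rho> R by (intro divide_right_mono mult_left_mono add_mono power_mono) auto
      also have "\<dots> < 1"
        using \<rho> R by simp
      finally show ?thesis .
    qed
    have sub: "cball 0 r \<subseteq> ball (0::complex) (\<rho> n)"
      using \<rho> R by (cases "r \<ge> 0") auto
    have "ball 0 (r - 1) \<subseteq> H ` ball 0 r"
      using close Hh sub
      by (intro ball_subset_image_near_identity)
        (auto intro: holomorphic_on_imp_continuous_on holomorphic_on_subset)
    have "ball (of_nat n) (r - 1) \<subseteq> h ` chart n ` ball 0 r"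
    proof
      fix w assume "w \<in> ball (of_nat n :: complex) (r - 1)"
      then have "w - of_nat n \<in> ball 0 (r - 1)"
        by (simp add: dist_norm norm_minus_commute)
      then obtain u where "u \<in> ball 0 r" "w - of_nat n = H u"
        using \<open>ball 0 (r - 1) \<subseteq> H ` ball 0 r\<close> by blast
      then show "w \<in> h ` chart n ` ball 0 r"
        by (auto simp: H_def)
    qed
    then show ?case
      using chartB sub B_subset_V[OF elim(2)] h_inj_B[OF elim(2)] by (auto simp: subset_iff)
  qed
qed

text \<open>In the charts both orbits converge to the common value \<open>h z\<close>, so eventually
  both iterates lie in \<open>B n\<close>. There \<open>h\<close> is injective, and by Abel's
  equation it still agrees on them.\<close>

lemma h_eq_imp_merge:
  assumes z: "z \<in> uhp" and w: "w \<in> uhp" and eq: "h z = h w"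
  obtains n where "(\<phi> ^^ n) z = (\<phi> ^^ n) w"
proof -
  define r where "r = cmod (h z) + 1"
  define u where "u z n = ((\<phi> ^^ n) z - orb n) / step n" for z n
  have cu: "chart n (u z n) = (\<phi> ^^ n) z" for z n
    using step_nonzero[of n] by (simp add: chart_def u_def)
  have ev: "\<forall>\<^sub>F n in sequentially. cmod (u x n) < r" if "x \<in> uhp" "h x = h z" for x
  proof (rule order_tendstoD)
    show "(\<lambda>n. cmod (u x n)) \<longlonglongrightarrow> cmod (h z)"
      using tendsto_norm[OF h_lim[OF that(1)]] that by (simp add: u_def)
  qed (simp add: r_def)
  have "\<forall>\<^sub>F n in sequentially. (\<phi> ^^ n) z = (\<phi> ^^ n) w"
    using ev[OF z refl] ev[OF w eq[symmetric]] eventually_chart[of r]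
  proof eventually_elim
    case (elim n)
    then have "(\<phi> ^^ n) z \<in> B n" "(\<phi> ^^ n) w \<in> B n"
      using cu[of n z] cu[of n w] by (metis image_subset_iff less_imp_le mem_cball_0)+
    moreover have "h ((\<phi> ^^ n) z) = h ((\<phi> ^^ n) w)"
      using h_iter z w eq by simp
    ultimately show ?case
      using elim by (auto dest: inj_onD)
  qed
  then show ?thesis
    using that eventually_happens trivial_limit_sequentially by blast
qed

text \<open>Equal values of \<open>h\<close> merge under some iterate, and iterates are injective on
  \<open>V\<close>. This handles a whole union of discs at once.\<close>

lemma h_inj_V: "inj_on h V"
proof (rule inj_onI)
  fix z w assume zw: "z \<in> V" "w \<in> V" "h z = h w"
  then obtain n where "(\<phi> ^^ n) z = (\<phi> ^^ n) w"
    using h_eq_imp_merge V_uhp by metis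
  then show "z = w"
    using inj_onD[OF inj_iter_V] zw by blast
qed

text \<open>For large \<open>n\<close> the image of \<open>h\<close> contains the disc of radius |w|
  + 1 about \<open>n\<close>, hence \<open>w + n\<close>. This lets \<open>F\<close> be defined on
  the whole plane.\<close>

lemma h_surj:
  obtains n z where "z \<in> uhp" "h z = w + of_nat n"
proof -
  have "\<forall>\<^sub>F n in sequentially. \<exists>z\<in>uhp. h z = w + of_nat n"
    using eventually_chart[of "cmod w + 2"]
  proof eventually_elim
    case (elim n)
    have "w + of_nat n \<in> ball (of_nat n) (cmod w + 2 - 1)"
      by (simp add: dist_norm)
    then obtain u where u: "u \<in> ball 0 (cmod w + 2)" "h (chart n u) = w + of_nat n"
      using elim by force
    then have "chart n u \<in> uhp"
      using elim B_uhp ball_subset_cball by blast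
    then show ?case using u by blast
  qed
  then show ?thesis
    using that eventually_happens trivial_limit_sequentially by blast
qed

end

subsection \<open>Entire solutions of the functional equation\<close>

lemma periodic_int:
  fixes F :: "complex \<Rightarrow> 'a"
  assumes "\<And>w. F (w + 1) = F w"
  shows "F (w + of_int m) = F w"
proof (induction m rule: int_induct[where k = 0])
  case (step1 i)
  then show ?case using assms[of "w + of_int i"] by (simp add: add.assoc)
next
  case (step2 i)
  then show ?case using assms[of "w + of_int (i - 1)"] by (simp add: add.assoc)
qed simp

text \<open>A 1-periodic \<open>F\<close> would be a bijection from the cylinder onto the plane: \<open>E = exp (2 \<pi> i F\<^sup>-\<^sup>1)\<close> is entire
  without zeros, so \<open>L / (2 \<pi> i)\<close> with \<open>E = exp L\<close> is an entire right inverse of \<open>F\<close>, hence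
  injective, hence affine, and \<open>F\<close> is affine.\<close>

lemma no_bijective_periodic_entire:
  fixes F :: "complex \<Rightarrow> complex"
  assumes F: "F holomorphic_on UNIV" and per: "\<And>w. F (w + 1) = F w" and surj: "surj F"
    and inj: "\<And>w w'. F w = F w' \<Longrightarrow> \<exists>m::int. w' = w + of_int m"
  shows False
proof -
  define E where "E y = exp (2 * of_real pi * \<i> * inv F y)" for y
  \<comment> \<open>The preimage chosen by \<open>inv F\<close> is irrelevant, since two preimages
    differ by an integer.\<close>
  have EF: "E (F w) = exp (2 * of_real pi * \<i> * w)" for w
  proof -
    define v where "v = inv F (F w)"
    have "F v = F w"
      unfolding v_def by (rule surj_f_inv_f[OF surj])
    then obtain m :: int where "w = v + of_int m"
      using inj by blast
    then have "2 * of_real pi * \<i> * w = 2 * of_real pi * \<i> * v + of_real (of_int (2 * m) * pi) * \<i>"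
      by (simp add: algebra_simps)
    then have "exp (2 * of_real pi * \<i> * w) = exp (2 * of_real pi * \<i> * v)"
      unfolding exp_eq by blast
    then show ?thesis
      by (simp add: E_def v_def)
  qed
  have "E holomorphic_on UNIV"
  proof -
    have "E field_differentiable at y" for y
    proof -
      obtain w where w: "y = F w"
        using surj by (rule surjE)
      \<comment> \<open>Two points of this disc are less than 1 apart, so they cannot differ by a
        nonzero integer. The local inverse of \<open>F\<close> then makes \<open>E\<close>
        holomorphic.\<close>
      have injb: "inj_on F (ball w (1/2))"
      proof (rule inj_onI)
        fix a b assume ab: "a \<in> ball w (1/2)" "b \<in> ball w (1/2)" "F a = F b"
        then obtain m :: int where m: "b = a + of_int m"
          using inj by blast
        have "dist a b < 1"
          using ab dist_triangle[of a b w] by (simp add: dist_commute)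
        then have "\<bar>of_int m :: real\<bar> < 1"
          by (simp add: m dist_norm)
        then show "a = b" using m by simp
      qed
      have Fb: "F holomorphic_on ball w (1/2)"
        using F by (rule holomorphic_on_subset) simp
      obtain g where g: "g holomorphic_on F ` ball w (1/2)"
        and gF: "\<And>z. z \<in> ball w (1/2) \<Longrightarrow> g (F z) = z"
        by (rule holomorphic_has_inverse[OF Fb open_ball injb]) blast
      have "(\<lambda>y. exp (2 * of_real pi * \<i> * g y)) holomorphic_on F ` ball w (1/2)"
        by (intro holomorphic_intros g)
      then have "E holomorphic_on F ` ball w (1/2)"
        by (rule holomorphic_transform) (auto simp: EF gF)
      moreover have "open (F ` ball w (1/2))"
        by (rule open_mapping_thm3[OF Fb open_ball injb])
      moreover have "y \<in> F ` ball w (1/2)"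
        using w by auto
      ultimately show ?thesis
        by (rule holomorphic_on_imp_differentiable_at)
    qed
    then show ?thesis
      by (simp add: holomorphic_on_def field_differentiable_at_within)
  qed
  then obtain L where L: "L holomorphic_on UNIV" and EL: "\<And>y. exp (L y) = E y"
    by (rule holomorphic_logarithm_exists[OF convex_UNIV open_UNIV, of E 0]) (auto simp: E_def)
  define M where "M y = L y / (2 * of_real pi * \<i>)" for y
  have FM: "F (M y) = y" for y
  proof -
    have "exp (L y) = exp (2 * of_real pi * \<i> * inv F y)"
      by (simp add: EL E_def)
    then obtain n :: int where "L y = 2 * of_real pi * \<i> * inv F y + of_real (of_int (2 * n) * pi) * \<i>"
      unfolding exp_eq by blast
    then have "M y = inv F y + of_int n"
      by (simp add: M_def field_simps)
    then show ?thesis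
      using periodic_int[of F, OF per] surj_f_inv_f[OF surj] by simp
  qed
  then have "inj M"
    by (metis injI)
  moreover have "M holomorphic_on UNIV"
    unfolding M_def by (intro holomorphic_intros L) auto
  ultimately obtain a b where a: "a \<noteq> 0" and M: "\<And>y. M y = a * y + b"
    using injective_entire_affine by metis
  \<comment> \<open>Periodicity of \<open>F\<close> identifies the two values of \<open>M\<close>,
    but \<open>F (M y) = y\<close> separates 1/a from 0.\<close>
  have "M (0 + 1 / a) = M 0 + 1"
    using a by (simp add: M)
  then have "F (M (1 / a)) = F (M 0)"
    using per[of "M 0"] by simp
  then show False
    using a by (simp add: FM)
qed

text \<open>If \<open>T z = a z\<close> and \<open>F w\<^sub>0 = 0\<close>, then \<open>F\<close> takes a common nonzero value near \<open>w\<^sub>0\<close> and near \<open>w\<^sub>0 + 1\<close>; this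
  forces \<open>a = 1\<close>.\<close>

lemma inj_of_canonical_factor:
  fixes F T :: "complex \<Rightarrow> complex"
  assumes F: "F holomorphic_on UNIV" and FT: "\<And>w. F (w + 1) = T (F w)" and surj: "surj F"
    and inj: "\<And>w w'. F w = F w' \<Longrightarrow> \<exists>m::int. w' = w + of_int m"
    and T: "T = (\<lambda>z. z + 1) \<or> (\<exists>a. a \<noteq> 0 \<and> T = (\<lambda>z. a * z))"
  shows "inj F"
  using T
proof (elim disjE exE conjE)
  assume T: "T = (\<lambda>z. z + 1)"
  \<comment> \<open>\<open>F w - w\<close> is 1-periodic, so a shift by \<open>m\<close> changes
    \<open>F\<close> by exactly \<open>m\<close>.\<close>
  have *: "F (w + of_int m) - (w + of_int m) = F w - w" for w m
    by (rule periodic_int[of "\<lambda>w. F w - w"]) (simp add: FT T)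
  show "inj F"
  proof (rule injI)
    fix w w' assume eq: "F w = F w'"
    then obtain m :: int where "w' = w + of_int m"
      using inj by blast
    then show "w = w'"
      using *[of w m] eq by simp
  qed
next
  fix a assume a: "a \<noteq> 0" and T: "T = (\<lambda>z. a * z)"
  obtain w0 where w0: "F w0 = 0"
    using surj by (metis surjD)
  then have w1: "F (w0 + 1) = 0"
    by (simp add: FT T)
  have "\<not> F constant_on UNIV"
    using surj unfolding constant_on_def surj_def by (metis UNIV_I zero_neq_one)
  then have op: "open (F ` ball w r)" for w r
    by (intro open_mapping_thm[OF F]) auto
  \<comment> \<open>An open set containing 0, hence containing some \<open>y \<noteq> 0\<close>. Its
    preimages \<open>w\<close>, \<open>w'\<close> differ by an integer less than 1 away from 1, that
    is by 1, and then \<open>y = a * y\<close>.\<close>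
  define N where "N = F ` ball w0 (1/4) \<inter> F ` ball (w0 + 1) (1/4)"
  have "open N"
    unfolding N_def by (intro open_Int op)
  moreover have "0 \<in> N"
    unfolding N_def using w0 w1 by (force intro: image_eqI[of _ F])
  ultimately have "N \<noteq> {0}"
    by (metis not_open_singleton)
  with \<open>0 \<in> N\<close> obtain y where y: "y \<in> N" "y \<noteq> 0"
    by blast
  then obtain w w' where w: "w \<in> ball w0 (1/4)" "F w = y" and w': "w' \<in> ball (w0 + 1) (1/4)" "F w' = y"
    unfolding N_def by auto
  then obtain m :: int where m: "w' = w + of_int m"
    using inj by metis
  have "cmod ((w0 + 1 - w') - (w0 - w)) < 1"
    using norm_triangle_ineq4[of "w0 + 1 - w'" "w0 - w"] w w' by (simp add: dist_norm)
  then have "cmod (of_int (1 - m)) < 1"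
    by (simp add: m)
  then have "\<bar>1 - m\<bar> < 1"
    by (simp only: norm_of_int)
  then have "m = 1" by simp
  then have "a = 1"
    using FT[of w] w w' y m by (simp add: T)
  then show "inj F"
    using no_bijective_periodic_entire[OF F _ surj inj] FT T by simp
qed

text \<open>\<open>F\<close> is affine with slope \<open>a \<noteq> 0\<close>, so the functional
  equation reads \<open>T y = y + a\<close>. Among the standard forms this leaves only
  \<open>z + 1\<close>, with \<open>a = 1\<close>.\<close>

lemma translation_of_inj_factor:
  fixes F T :: "complex \<Rightarrow> complex"
  assumes F: "F holomorphic_on UNIV" and FT: "\<And>w. F (w + 1) = T (F w)" and inj: "inj F"
    and T: "T = (\<lambda>z. z + 1) \<or> (\<exists>a. a \<noteq> 0 \<and> T = (\<lambda>z. a * z))"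
  obtains c where "T = (\<lambda>z. z + 1)" "\<And>w. F w = w + c"
proof -
  obtain a b where a: "a \<noteq> 0" and Fab: "\<And>w. F w = a * w + b"
    using injective_entire_affine[OF F inj] by blast
  have Ty: "T y = y + a" for y
    using FT[of "(y - b) / a"] a by (simp add: Fab distrib_left)
  from T have "T = (\<lambda>z. z + 1)"
    using Ty[of 0] a by auto
  moreover from this have "a = 1"
    using Ty[of 0] by simp
  ultimately show ?thesis
    using that Fab by auto
qed

subsection \<open>Grand orbits and canonical solutions\<close>

lemma equiv_grand_orbit_rel: "equiv X (grand_orbit_rel X \<psi>)"
proof (rule equivI)
  show "grand_orbit_rel X \<psi> \<subseteq> X \<times> X"
    by (auto simp: grand_orbit_rel_def)
  show "refl_on X (grand_orbit_rel X \<psi>)"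
    by (auto simp: refl_on_def grand_orbit_rel_def)
  show "sym (grand_orbit_rel X \<psi>)"
    unfolding sym_def grand_orbit_rel_def by (auto dest: sym)
  show "trans (grand_orbit_rel X \<psi>)"
  proof (rule transI)
    fix x y z assume xy: "(x, y) \<in> grand_orbit_rel X \<psi>" and yz: "(y, z) \<in> grand_orbit_rel X \<psi>"
    then obtain n k m l where e: "(\<psi> ^^ n) x = (\<psi> ^^ k) y" "(\<psi> ^^ m) y = (\<psi> ^^ l) z"
      by (auto simp: grand_orbit_rel_def)
    have "(\<psi> ^^ (m + n)) x = (\<psi> ^^ (m + k)) y"
      by (simp add: funpow_add e(1))
    also have "\<dots> = (\<psi> ^^ (k + m)) y"
      by (simp add: add.commute)
    also have "\<dots> = (\<psi> ^^ (k + l)) z"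
      by (simp add: funpow_add e(2))
    finally show "(x, z) \<in> grand_orbit_rel X \<psi>"
      using xy yz unfolding grand_orbit_rel_def by blast
  qed
qed

lemma funpow_semiconj:
  assumes "\<forall>z\<in>X. \<phi> z \<in> X" "\<forall>z\<in>X. f (\<phi> z) = T (f z)" "z \<in> X"
  shows "f ((\<phi> ^^ n) z) = (T ^^ n) (f z)"
proof -
  have "(\<phi> ^^ n) z \<in> X \<and> f ((\<phi> ^^ n) z) = (T ^^ n) (f z)"
    by (induction n) (use assms in auto)
  then show ?thesis ..
qed

text \<open>Injectivity and surjectivity of the induced map in terms of representatives, so that
  quotient sets disappear from the later arguments.\<close>

lemma canonical_iff:
  assumes X: "\<forall>z\<in>uhp. \<phi> z \<in> uhp" and semi: "\<forall>z\<in>uhp. \<sigma> (\<phi> z) = \<tau> (\<sigma> z)"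
  shows "canonical \<phi> \<sigma> \<tau> \<longleftrightarrow>
    (\<forall>z\<in>uhp. \<forall>w\<in>uhp. (\<exists>n k. (\<tau> ^^ n) (\<sigma> z) = (\<tau> ^^ k) (\<sigma> w)) \<longrightarrow> (\<exists>n k. (\<phi> ^^ n) z = (\<phi> ^^ k) w)) \<and>
    (\<forall>y. \<exists>z\<in>uhp. \<exists>n k. (\<tau> ^^ n) y = (\<tau> ^^ k) (\<sigma> z))"
proof -
  let ?R = "grand_orbit_rel uhp \<phi>" and ?S = "grand_orbit_rel UNIV \<tau>"
  note R = equiv_grand_orbit_rel[of uhp \<phi>] and S = equiv_grand_orbit_rel[of UNIV \<tau>]
  have RS: "(\<sigma> z, \<sigma> w) \<in> ?S" if "(z, w) \<in> ?R" for z w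
  proof -
    from that obtain n k where "z \<in> uhp" "w \<in> uhp" "(\<phi> ^^ n) z = (\<phi> ^^ k) w"
      by (auto simp: grand_orbit_rel_def)
    then have "(\<tau> ^^ n) (\<sigma> z) = (\<tau> ^^ k) (\<sigma> w)"
      using funpow_semiconj[OF X semi] by metis
    then show ?thesis
      by (auto simp: grand_orbit_rel_def)
  qed
  have ind: "induced_map \<sigma> \<tau> (?R `` {z}) = ?S `` {\<sigma> z}" if z: "z \<in> uhp" for z
  proof
    show "induced_map \<sigma> \<tau> (?R `` {z}) \<subseteq> ?S `` {\<sigma> z}"
      unfolding induced_map_def using RS S unfolding equiv_def trans_def by blast
    show "?S `` {\<sigma> z} \<subseteq> induced_map \<sigma> \<tau> (?R `` {z})"
      unfolding induced_map_def using equiv_class_self[OF R z] by blast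
  qed
  have Sy: "?S `` {x} = ?S `` {y} \<longleftrightarrow> (x, y) \<in> ?S" for x y
    by (rule eq_equiv_class_iff[OF S]) auto
  have Rz: "?R `` {x} = ?R `` {y} \<longleftrightarrow> (x, y) \<in> ?R" if "x \<in> uhp" "y \<in> uhp" for x y
    by (rule eq_equiv_class_iff[OF R that])
  have GO: "grand_orbits X \<psi> = (\<lambda>z. grand_orbit_rel X \<psi> `` {z}) ` X" for X :: "complex set" and \<psi>
    by (auto simp: grand_orbits_def quotient_def)
  have "inj_on (induced_map \<sigma> \<tau>) (grand_orbits uhp \<phi>) \<longleftrightarrow>
      (\<forall>z\<in>uhp. \<forall>w\<in>uhp. (\<sigma> z, \<sigma> w) \<in> ?S \<longrightarrow> (z, w) \<in> ?R)"
    unfolding GO inj_on_def using ind Sy Rz by auto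
  moreover have "induced_map \<sigma> \<tau> ` grand_orbits uhp \<phi> = (\<lambda>z. ?S `` {\<sigma> z}) ` uhp"
    unfolding GO image_image using ind by (intro image_cong) auto
  then have "induced_map \<sigma> \<tau> ` grand_orbits uhp \<phi> = grand_orbits UNIV \<tau> \<longleftrightarrow>
      (\<forall>y. \<exists>z\<in>uhp. (y, \<sigma> z) \<in> ?S)"
  proof -
    assume eq: "induced_map \<sigma> \<tau> ` grand_orbits uhp \<phi> = (\<lambda>z. ?S `` {\<sigma> z}) ` uhp"
    have "(\<lambda>z. ?S `` {\<sigma> z}) ` uhp = range (\<lambda>y. ?S `` {y}) \<longleftrightarrow>
        (\<forall>y. ?S `` {y} \<in> (\<lambda>z. ?S `` {\<sigma> z}) ` uhp)"
      by blast
    also have "\<dots> \<longleftrightarrow> (\<forall>y. \<exists>z\<in>uhp. (y, \<sigma> z) \<in> ?S)"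
      unfolding image_iff Sy ..
    finally show ?thesis
      unfolding eq GO[of UNIV] .
  qed
  ultimately show ?thesis
    unfolding canonical_def bij_betw_def by (simp add: grand_orbit_rel_def)
qed

lemma funpow_shift:
  fixes F :: "'a::semiring_1 \<Rightarrow> 'b"
  assumes "\<And>w. F (w + 1) = T (F w)"
  shows "F (w + of_nat m) = (T ^^ m) (F w)"
proof (induction m)
  case (Suc m)
  have "F (w + of_nat (Suc m)) = F (w + of_nat m + 1)"
    by (simp add: ac_simps)
  then show ?case
    using Suc assms by simp
qed simp

text \<open>Makes every iterate of \<open>T\<close> invertible, with an affine inverse.\<close>

lemma funpow_affine:
  fixes a b :: complex
  assumes "a \<noteq> 0"
  obtains A B where "A \<noteq> 0" "\<And>y. ((\<lambda>z. a * z + b) ^^ n) y = A * y + B"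
proof -
  have "\<exists>A B. A \<noteq> 0 \<and> (\<forall>y. ((\<lambda>z. a * z + b) ^^ n) y = A * y + B)"
  proof (induction n)
    case 0
    show ?case by (intro exI[of _ 1] exI[of _ 0]) simp
  next
    case (Suc n)
    then obtain A B where "A \<noteq> 0" "\<And>y. ((\<lambda>z. a * z + b) ^^ n) y = A * y + B"
      by blast
    then show ?case
      using assms by (intro exI[of _ "a * A"] exI[of _ "a * B + b"]) (simp add: algebra_simps)
  qed
  then show ?thesis using that by blast
qed

section \<open>Factorisation of solutions through \<open>h\<close>\<close>

context zero_step
begin

text \<open>Merging of orbits makes \<open>F\<close> independent of the chosen \<open>n\<close> and
  \<open>z\<close>. On each disc \<open>F\<close> is the composition of a shift by \<open>n\<close>,
  a local inverse of \<open>h\<close> on \<open>B n\<close>, \<open>f\<close>, and the inverse of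
  \<open>T ^^ n\<close>, hence holomorphic.\<close>

lemma factor_through_h:
  assumes f: "f holomorphic_on uhp" and semi: "\<And>z. z \<in> uhp \<Longrightarrow> f (\<phi> z) = T (f z)"
    and T: "T = (\<lambda>y. a * y + b)" and a: "a \<noteq> 0"
  obtains F where "F holomorphic_on UNIV" "\<And>z. z \<in> uhp \<Longrightarrow> f z = F (h z)"
    "\<And>w. F (w + 1) = T (F w)"
proof -
  have fn: "f ((\<phi> ^^ n) z) = (T ^^ n) (f z)" if "z \<in> uhp" for n z
    using semi that phi_uhp by (intro funpow_semiconj[of uhp]) auto
  have injT: "(T ^^ n) x = (T ^^ n) y \<Longrightarrow> x = y" for n x y
    using funpow_affine[OF a, of n b] unfolding T by (metis add_right_cancel mult_left_cancel)
  have surjT: "\<exists>y. (T ^^ n) y = x" for n x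
  proof -
    obtain A B where "A \<noteq> 0" "\<And>y. (T ^^ n) y = A * y + B"
      using funpow_affine[OF a, of n b] unfolding T by blast
    then show ?thesis
      by (intro exI[of _ "(x - B) / A"]) simp
  qed
  define F where "F w = (SOME y. \<exists>n z. z \<in> uhp \<and> h z = w + of_nat n \<and> (T ^^ n) y = f z)" for w
  have F: "(T ^^ n) (F w) = f z" if z: "z \<in> uhp" "h z = w + of_nat n" for n z and w :: complex
  proof -
    have "\<exists>y n z. z \<in> uhp \<and> h z = w + of_nat n \<and> (T ^^ n) y = f z"
      using h_surj[of w] surjT by metis
    from someI_ex[OF this] obtain n' z' where z': "z' \<in> uhp" "h z' = w + of_nat n'"
      and F': "(T ^^ n') (F w) = f z'"
      unfolding F_def by blast
    \<comment> \<open>Both sides equal \<open>w + n + n'\<close>; crossing the exponents makes the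
      two representations comparable.\<close>
    have "h ((\<phi> ^^ n') z) = h ((\<phi> ^^ n) z')"
      using z z' by (simp add: h_iter)
    then obtain m where "(\<phi> ^^ m) ((\<phi> ^^ n') z) = (\<phi> ^^ m) ((\<phi> ^^ n) z')"
      using h_eq_imp_merge iter_uhp z z' by metis
    then have "(T ^^ m) ((T ^^ n') (f z)) = (T ^^ m) ((T ^^ n) (f z'))"
      using fn iter_uhp z z' by metis
    then have "(T ^^ n') (f z) = (T ^^ n) ((T ^^ n') (F w))"
      using injT F' by metis
    also have "\<dots> = (T ^^ n') ((T ^^ n) (F w))"
      by (metis add.commute comp_apply funpow_add)
    finally show ?thesis
      using injT by metis
  qed
  have "F holomorphic_on UNIV"
  proof -
    have "F field_differentiable at w0" for w0
    proof -
      define r where "r = cmod w0 + 2"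
      obtain n where n: "chart n ` cball 0 r \<subseteq> B n" "inj_on h (B n)"
          "ball (of_nat n) (r - 1) \<subseteq> h ` chart n ` ball 0 r"
        using eventually_happens[OF eventually_chart[of r]] by auto
      have hB: "h holomorphic_on B n" "open (B n)"
        using h_holo B_uhp by (auto intro: holomorphic_on_subset simp: B_def)
      obtain g where g: "g holomorphic_on h ` B n" and gh: "\<And>z. z \<in> B n \<Longrightarrow> g (h z) = z"
        by (rule holomorphic_has_inverse[OF hB n(2)]) blast
      have sub: "w + of_nat n \<in> h ` B n" if "w \<in> ball 0 (r - 1)" for w
      proof -
        have "w + of_nat n \<in> ball (of_nat n) (r - 1)"
          using that by (simp add: dist_norm)
        then show ?thesis
          using n(1,3) ball_subset_cball by blast
      qed
      have gB: "g x \<in> B n" "h (g x) = x" if "x \<in> h ` B n" for x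
        using that gh by auto
      obtain A C where A: "A \<noteq> 0" "\<And>y. (T ^^ n) y = A * y + C"
        using funpow_affine[OF a, of n b] unfolding T by blast
      have "(\<lambda>w. g (w + of_nat n)) holomorphic_on ball 0 (r - 1)"
        by (intro holomorphic_on_compose_gen[OF _ g, unfolded o_def, of "\<lambda>w. w + of_nat n"] holomorphic_intros)
          (use sub in auto)
      then have "(\<lambda>w. f (g (w + of_nat n))) holomorphic_on ball 0 (r - 1)"
        by (rule holomorphic_on_compose_gen[OF _ f, unfolded o_def]) (use sub gB B_uhp in blast)
      then have "(\<lambda>w. (f (g (w + of_nat n)) - C) / A) holomorphic_on ball 0 (r - 1)"
        using A by (intro holomorphic_intros) auto
      then have "F holomorphic_on ball 0 (r - 1)"
      proof (rule holomorphic_transform)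
        fix w :: complex assume "w \<in> ball 0 (r - 1)"
        then have "(T ^^ n) (F w) = f (g (w + of_nat n))"
          using subsetD[OF B_uhp gB(1)[OF sub]] gB(2)[OF sub] by (intro F) auto
        then show "(f (g (w + of_nat n)) - C) / A = F w"
          using A by (simp add: field_simps)
      qed
      then show ?thesis
        by (rule holomorphic_on_imp_differentiable_at) (auto simp: r_def)
    qed
    then show ?thesis
      by (simp add: holomorphic_on_def field_differentiable_at_within)
  qed
  moreover have "f z = F (h z)" if "z \<in> uhp" for z
    using F[OF that, of "h z" 0] by simp
  moreover have "F (w + 1) = T (F w)" for w :: complex
  proof -
    obtain n z where z: "z \<in> uhp" "h z = w + 1 + of_nat n"
      by (rule h_surj)
    have "(T ^^ n) (F (w + 1)) = f z"
      using F z by blast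
    moreover have "(T ^^ Suc n) (F w) = f z"
      using z by (intro F) (auto simp: algebra_simps)
    ultimately have "(T ^^ n) (F (w + 1)) = (T ^^ n) (T (F w))"
      unfolding funpow_Suc_right by simp
    then show ?thesis by (rule injT)
  qed
  ultimately show ?thesis using that by blast
qed

lemma disc_union_eq_chart:
  assumes "\<And>k. R k > 0"
  shows "disc_union \<phi> z0 R M = (\<Union>k. \<Union>n\<in>{M k..}. chart n ` ball 0 (R k))"
proof -
  have "(\<lambda>w. (\<phi> ^^ n) z0 + ((\<phi> ^^ Suc n) z0 - (\<phi> ^^ n) z0) * of_real r * w) ` ball 0 1
      = chart n ` ball 0 r" if r: "r > 0" for n r
  proof -
    have "ball (0::complex) r = (\<lambda>w. of_real r * w) ` ball 0 1"
    proof
      show "ball (0::complex) r \<subseteq> (\<lambda>w. of_real r * w) ` ball 0 1"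
        using r by (auto intro!: image_eqI[of _ _ "_ / of_real r"] simp: norm_divide)
      show "(\<lambda>w. of_real r * w) ` ball 0 1 \<subseteq> ball (0::complex) r"
        using r by (auto simp: norm_mult)
    qed
    then show ?thesis
      by (simp add: image_image chart_def orb_def step_def mult.assoc)
  qed
  then show ?thesis
    using assms unfolding disc_union_def by simp
qed

text \<open>A common integer shift moves \<open>w\<close> and \<open>w'\<close> into a disc covered
  by \<open>h\<close> on one of the discs of the union. There \<open>f\<close> is injective, and the
  shift preserves equality of the values of \<open>F\<close>.\<close>

lemma inj_factor_of_univalence_covering:
  assumes u: "univalence_covering \<phi> z0 f" and fF: "\<And>z. z \<in> uhp \<Longrightarrow> f z = F (h z)"
    and FT: "\<And>w. F (w + 1) = T (F w)"
  shows "inj F"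
proof (rule injI)
  fix w w' assume eq: "F w = F w'"
  obtain R M where R: "\<And>k. R k > 0" "filterlim R at_top sequentially"
    and U: "disc_union \<phi> z0 R M \<subseteq> uhp" "inj_on f (disc_union \<phi> z0 R M)"
    using u unfolding univalence_covering_def by blast
  obtain k where k: "R k > cmod w + cmod w' + 1"
    using R(2) unfolding filterlim_at_top_dense
    by (metis eventually_happens trivial_limit_sequentially)
  have "\<forall>\<^sub>F n in sequentially. n \<ge> M k \<and> ball (of_nat n) (R k - 1) \<subseteq> h ` chart n ` ball 0 (R k)"
    using eventually_ge_at_top[of "M k"] eventually_chart[of "R k"] by eventually_elim auto
  then obtain n where n: "n \<ge> M k" "ball (of_nat n) (R k - 1) \<subseteq> h ` chart n ` ball 0 (R k)"
    using eventually_happens trivial_limit_sequentially by blast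
  have cU: "chart n ` ball 0 (R k) \<subseteq> disc_union \<phi> z0 R M"
    unfolding disc_union_eq_chart[OF R(1)] using n(1) by auto
  have wb: "w + of_nat n \<in> ball (of_nat n) (R k - 1)" "w' + of_nat n \<in> ball (of_nat n) (R k - 1)"
    using k norm_ge_zero[of w] norm_ge_zero[of w'] unfolding mem_ball dist_norm
    by (simp_all del: norm_ge_zero)
  obtain z where z: "w + of_nat n = h z" "z \<in> chart n ` ball 0 (R k)"
    using subsetD[OF n(2) wb(1)] by (rule imageE)
  obtain z' where z': "w' + of_nat n = h z'" "z' \<in> chart n ` ball 0 (R k)"
    using subsetD[OF n(2) wb(2)] by (rule imageE)
  have Fn: "F (x + of_nat m) = (T ^^ m) (F x)" for x :: complex and m
    by (rule funpow_shift) (rule FT)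
  have zU: "z \<in> disc_union \<phi> z0 R M" "z' \<in> disc_union \<phi> z0 R M"
    by (rule subsetD[OF cU z(2)], rule subsetD[OF cU z'(2)])
  have zu: "z \<in> uhp" "z' \<in> uhp"
    using zU U(1) by (meson subsetD)+
  have "f z = F (w + of_nat n)"
    using fF[OF zu(1)] unfolding z(1) .
  moreover have "f z' = F (w' + of_nat n)"
    using fF[OF zu(2)] unfolding z'(1) .
  ultimately have "f z = f z'"
    using Fn eq by metis
  then have "z = z'"
    using inj_onD[OF U(2) _ zU] by simp
  then have "w + of_nat n = w' + of_nat n"
    unfolding z(1) z'(1) by (rule arg_cong)
  then show "w = w'"
    by (rule add_right_imp_eq)
qed

text \<open>Inside \<open>V\<close> univalence is automatic. For n >= M k the image contains the
  disc of radius \<open>R k - 1\<close> about \<open>n + c\<close>, and such discs, at unit spacing,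
  fill half-strips.\<close>

lemma univalence_covering_translate:
  assumes f: "\<And>z. z \<in> uhp \<Longrightarrow> f z = h z + c"
  shows "univalence_covering \<phi> z0 f"
proof -
  define R where "R k = real k + 1" for k
  define good where "good r n \<longleftrightarrow> chart n ` ball 0 r \<subseteq> V \<and>
     ball (of_nat n) (r - 1) \<subseteq> h ` chart n ` ball 0 r" for r n
  have "\<exists>N. \<forall>n\<ge>N. good (R k) n" for k
    using eventually_chart[of "R k"] unfolding good_def eventually_sequentially
    by (meson ball_subset_cball image_mono order_trans)
  then obtain N where N: "\<And>k n. n \<ge> N k \<Longrightarrow> good (R k) n"
    by metis
  \<comment> \<open>The sum gives monotonicity and \<open>M k \<ge> N k\<close>, the summand
    \<open>k\<close> gives divergence, and \<open>Suc\<close> gives positivity.\<close>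
  define M where "M k = Suc (k + (\<Sum>j\<le>k. N j))" for k
  have M_ge: "M k \<ge> N k" "M k \<ge> k" for k
    using member_le_sum[of k "{..k}" N] by (simp_all add: M_def)
  have M_mono: "incseq M"
    by (rule incseq_SucI) (simp add: M_def)
  define U where "U = disc_union \<phi> z0 R M"
  have U_eq: "U = (\<Union>k. \<Union>n\<in>{M k..}. chart n ` ball 0 (R k))"
    unfolding U_def by (rule disc_union_eq_chart) (simp add: R_def)
  have good: "good (R k) n" if "n \<ge> M k" for k n
    using that M_ge(1)[of k] N by (meson order_trans)
  have UV: "U \<subseteq> V"
    unfolding U_eq using good unfolding good_def by blast
  then have Uu: "U \<subseteq> uhp"
    using V_uhp by blast
  have cover: "ball (of_nat n + c) (R k - 1) \<subseteq> f ` U" if n: "n \<ge> M k" for k n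
  proof
    fix w assume "w \<in> ball (of_nat n + c) (R k - 1)"
    then have "w - c \<in> ball (of_nat n) (R k - 1)"
      by (simp add: dist_norm algebra_simps)
    then obtain z where z: "z \<in> chart n ` ball 0 (R k)" "w - c = h z"
      using good[OF n] unfolding good_def by (metis imageE subsetD)
    then have "z \<in> U"
      unfolding U_eq using n by blast
    moreover from this have "f z = w"
      using f[of z] Uu z by (metis diff_add_cancel subsetD)
    ultimately show "w \<in> f ` U"
      by blast
  qed
  have "lateral_tangent (f ` U)"
    unfolding lateral_tangent_def
  proof (intro allI impI, elim conjE)
    fix r :: "nat \<Rightarrow> real"
    assume r: "incseq r" "filterlim r at_top sequentially"
    \<comment> \<open>Chosen so that \<open>R (k n) - 1 \<ge> r n + |Im c| + 1\<close>: the height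
      of the strip shifted by \<open>c\<close>, plus 1 for the horizontal distance to a
      centre.\<close>
    define k where "k n = nat \<lceil>r n + \<bar>Im c\<bar>\<rceil> + 2" for n
    define t where "t n = real (M (k n)) + Re c" for n
    have k_ge: "real (k n) \<ge> r n + \<bar>Im c\<bar> + 2" for n
      unfolding k_def by linarith
    have "incseq k"
      unfolding k_def incseq_def using incseqD[OF r(1)]
      by (intro allI impI add_right_mono nat_mono ceiling_mono)
    then have "incseq t"
      using M_mono by (auto simp: incseq_def t_def)
    moreover have "filterlim t at_top sequentially"
    proof (rule filterlim_at_top_mono)
      show "filterlim (\<lambda>n. Re c + r n) at_top sequentially"
        by (rule filterlim_tendsto_add_at_top[OF tendsto_const r(2)])
      have "Re c + r n \<le> t n" for n
        using k_ge[of n] M_ge(2)[of "k n"] unfolding t_def by linarith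
      then show "\<forall>\<^sub>F n in sequentially. Re c + r n \<le> t n" by simp
    qed
    moreover have "{z. Re z > t n \<and> \<bar>Im z\<bar> < r n} \<subseteq> f ` U" for n
    proof
      fix z assume "z \<in> {z. Re z > t n \<and> \<bar>Im z\<bar> < r n}"
      then have z: "Re z > t n" "\<bar>Im z\<bar> < r n" by auto
      define m where "m = nat \<lfloor>Re (z - c)\<rfloor>"
      have Rez: "Re (z - c) > real (M (k n))"
        using z(1) by (simp add: t_def)
      then have m: "m \<ge> M (k n)"
        unfolding m_def by linarith
      have m1: "\<bar>Re (z - c) - real m\<bar> < 1"
        unfolding m_def using Rez by linarith
      have "cmod (z - (of_nat m + c)) \<le> \<bar>Re (z - (of_nat m + c))\<bar> + \<bar>Im (z - (of_nat m + c))\<bar>"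
        by (rule cmod_le)
      also have "\<dots> < 1 + (r n + \<bar>Im c\<bar>)"
        using m1 z(2) by simp
      also have "\<dots> \<le> R (k n) - 1"
        using k_ge[of n] by (simp add: R_def)
      finally have "z \<in> ball (of_nat m + c) (R (k n) - 1)"
        by (simp add: dist_norm norm_minus_commute)
      then show "z \<in> f ` U"
        using cover[OF m] by blast
    qed
    ultimately show "\<exists>t. incseq t \<and> filterlim t at_top sequentially \<and>
        (\<forall>n. {z. Re z > t n \<and> \<bar>Im z\<bar> < r n} \<subseteq> f ` U)"
      by blast
  qed
  moreover have "f holomorphic_on U"
  proof (rule holomorphic_transform)
    show "(\<lambda>z. h z + c) holomorphic_on U"
      by (intro holomorphic_intros holomorphic_on_subset[OF h_holo Uu])
  qed (use f Uu in auto)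
  moreover have "inj_on f U"
    using inj_on_subset[OF h_inj_V UV] f Uu by (auto simp: inj_on_def subset_iff)
  moreover have "filterlim R at_top sequentially" "incseq R"
    unfolding R_def
    by (auto simp: incseq_def intro!: filterlim_at_top_mono[OF filterlim_real_sequentially])
  moreover have "filterlim M at_top sequentially"
    by (rule filterlim_at_top_mono[OF filterlim_ident]) (simp add: M_ge)
  ultimately show ?thesis
    unfolding univalence_covering_def U_def[symmetric]
    using M_mono Uu unfolding U_def
    by (intro exI[of _ R] exI[of _ M]) (auto simp: R_def M_def)
qed

text \<open>The equivalences for \<open>\<tau>\<close> in its standard form. Each of the last two
  conditions forces the factor \<open>F\<close> to be injective, hence a translation.\<close>

lemma canonical_solution_iff:
  assumes f: "f holomorphic_on uhp" and semi: "\<And>z. z \<in> uhp \<Longrightarrow> f (\<phi> z) = T (f z)"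
    and T: "T = (\<lambda>z. z + 1) \<or> (\<exists>a. a \<noteq> 0 \<and> T = (\<lambda>z. a * z))"
  shows "(T = (\<lambda>z. z + 1) \<and> (\<exists>c. \<forall>z\<in>uhp. f z = h z + c)) \<longleftrightarrow> canonical \<phi> f T"
    and "canonical \<phi> f T \<longleftrightarrow> univalence_covering \<phi> z0 f"
proof -
  let ?A = "T = (\<lambda>z. z + 1) \<and> (\<exists>c. \<forall>z\<in>uhp. f z = h z + c)"
  obtain a b where Tab: "T = (\<lambda>z. a * z + b)" and a: "a \<noteq> 0"
  proof -
    from T show ?thesis
    proof
      assume "T = (\<lambda>z. z + 1)"
      then show ?thesis by (intro that[of 1 1]) auto
    next
      assume "\<exists>a. a \<noteq> 0 \<and> T = (\<lambda>z. a * z)"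
      then show ?thesis using that[of _ 0] by auto
    qed
  qed
  obtain F where F: "F holomorphic_on UNIV" and fF: "\<And>z. z \<in> uhp \<Longrightarrow> f z = F (h z)"
    and FT: "\<And>w. F (w + 1) = T (F w)"
    using factor_through_h[OF f semi Tab a] by blast
  have can_iff: "canonical \<phi> f T \<longleftrightarrow>
    (\<forall>z\<in>uhp. \<forall>w\<in>uhp. (\<exists>n k. (T ^^ n) (f z) = (T ^^ k) (f w)) \<longrightarrow> (\<exists>n k. (\<phi> ^^ n) z = (\<phi> ^^ k) w)) \<and>
    (\<forall>y. \<exists>z\<in>uhp. \<exists>n k. (T ^^ n) y = (T ^^ k) (f z))"
    by (rule canonical_iff) (use semi phi_uhp in auto)
  have A_if_inj: ?A if "inj F"
    using translation_of_inj_factor[OF F FT that T] fF by metis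
  have A_imp_canonical: "canonical \<phi> f T" if A: ?A
  proof -
    from A obtain c where T1: "T = (\<lambda>z. z + 1)" and fh: "\<And>z. z \<in> uhp \<Longrightarrow> f z = h z + c"
      by blast
    have Tn: "(T ^^ n) y = y + of_nat n" for n y
      by (induction n) (simp_all add: T1)
    show ?thesis
      unfolding can_iff
    proof (intro conjI ballI impI allI)
      fix z w assume zw: "z \<in> uhp" "w \<in> uhp" and "\<exists>n k. (T ^^ n) (f z) = (T ^^ k) (f w)"
      then obtain n k where "h z + of_nat n = h w + of_nat k"
        by (auto simp: Tn fh)
      then have "h ((\<phi> ^^ n) z) = h ((\<phi> ^^ k) w)"
        using zw by (simp add: h_iter)
      then obtain m where "(\<phi> ^^ m) ((\<phi> ^^ n) z) = (\<phi> ^^ m) ((\<phi> ^^ k) w)"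
        using h_eq_imp_merge zw iter_uhp by metis
      then show "\<exists>n k. (\<phi> ^^ n) z = (\<phi> ^^ k) w"
        by (metis comp_apply funpow_add)
    next
      fix y
      obtain n z where z: "z \<in> uhp" "h z = y - c + of_nat n"
        by (rule h_surj)
      then have "(T ^^ n) y = (T ^^ 0) (f z)"
        by (simp add: Tn fh)
      then show "\<exists>z\<in>uhp. \<exists>n k. (T ^^ n) y = (T ^^ k) (f z)"
        using z by blast
    qed
  qed
  have canonical_imp_A: ?A if can: "canonical \<phi> f T"
  proof -
    have Fn: "F (x + of_nat m) = (T ^^ m) (F x)" for x :: complex and m
      by (rule funpow_shift) (rule FT)
    have injT: "(T ^^ n) x = (T ^^ n) y \<Longrightarrow> x = y" for n x y
      using funpow_affine[OF a, of n b] unfolding Tab by (metis add_right_cancel mult_left_cancel)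
    have 1: "\<And>z w n k. \<lbrakk>z \<in> uhp; w \<in> uhp; (T ^^ n) (f z) = (T ^^ k) (f w)\<rbrakk>
        \<Longrightarrow> \<exists>n k. (\<phi> ^^ n) z = (\<phi> ^^ k) w"
      and 2: "\<And>y. \<exists>z\<in>uhp. \<exists>n k. (T ^^ n) y = (T ^^ k) (f z)"
      using can unfolding can_iff by blast+
    have "surj F"
      unfolding surj_def
    proof
      fix y
      obtain z n k where z: "z \<in> uhp" "(T ^^ n) y = (T ^^ k) (f z)"
        using 2 by blast
      \<comment> \<open>The preimage of \<open>y\<close> is \<open>h z + k - n\<close>, since
        \<open>T ^^ n\<close> is injective.\<close>
      have "(T ^^ n) (F (h z + of_nat k - of_nat n)) = F (h z + of_nat k)"
        by (simp flip: Fn)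
      also have "\<dots> = (T ^^ n) y"
        using z by (simp add: Fn fF)
      finally show "\<exists>x. y = F x"
        using injT by metis
    qed
    moreover have "\<exists>m::int. w' = w + of_int m" if eq: "F w = F w'" for w w'
    proof -
      obtain n z where z: "z \<in> uhp" "h z = w + of_nat n"
        by (rule h_surj)
      obtain n' z' where z': "z' \<in> uhp" "h z' = w' + of_nat n'"
        by (rule h_surj)
      \<comment> \<open>Both sides are \<open>T ^^ (n + n')\<close> applied to
        \<open>F w = F w'\<close>. Thus \<open>z\<close> and \<open>z'\<close> share a grand orbit,
        and Abel's equation makes \<open>h z - h z'\<close> an integer.\<close>
      have "(T ^^ n') (f z) = (T ^^ n) (f z')"
        using z z' eq fF Fn by (metis add.commute comp_apply funpow_add)
      then obtain i j where "(\<phi> ^^ i) z = (\<phi> ^^ j) z'"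
        using 1 z z' by blast
      then have "h z + of_nat i = h z' + of_nat j"
        using h_iter z z' by metis
      then have "w' = w + of_int (int n + int i - int n' - int j)"
        using z z' by (simp add: algebra_simps)
      then show ?thesis by blast
    qed
    ultimately have "inj F"
      using inj_of_canonical_factor[OF F FT _ _ T] by blast
    then show ?thesis by (rule A_if_inj)
  qed
  show "?A \<longleftrightarrow> canonical \<phi> f T"
    using A_imp_canonical canonical_imp_A by blast
  show "canonical \<phi> f T \<longleftrightarrow> univalence_covering \<phi> z0 f"
    using A_imp_canonical canonical_imp_A A_if_inj univalence_covering_translate
      inj_factor_of_univalence_covering[OF _ fF FT] by metis
qed

end

text \<open>The bijection \<open>inv \<beta>\<close> conjugates \<open>\<tau>\<close> to its
  standard form and so carries grand orbits onto grand orbits.\<close>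

lemma canonical_conjugate:
  assumes X: "\<forall>z\<in>uhp. \<phi> z \<in> uhp" and semi: "\<forall>z\<in>uhp. \<sigma> (\<phi> z) = \<tau> (\<sigma> z)"
    and \<beta>: "bij \<beta>"
  shows "canonical \<phi> (inv \<beta> \<circ> \<sigma>) (inv \<beta> \<circ> \<tau> \<circ> \<beta>) \<longleftrightarrow> canonical \<phi> \<sigma> \<tau>"
proof -
  have ib: "inv \<beta> (\<beta> x) = x" "\<beta> (inv \<beta> x) = x" for x
    using \<beta> by (simp_all add: bij_is_inj bij_is_surj surj_f_inv_f)
  have Tn: "((inv \<beta> \<circ> \<tau> \<circ> \<beta>) ^^ n) (inv \<beta> y) = inv \<beta> ((\<tau> ^^ n) y)" for n y
    by (induction n) (simp_all add: ib)
  have ibi: "inv \<beta> x = inv \<beta> y \<longleftrightarrow> x = y" for x y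
    by (metis ib(2))
  have all: "(\<forall>y. P y) \<longleftrightarrow> (\<forall>y. P (inv \<beta> y))" for P
    by (metis ib(1))
  have semi': "\<forall>z\<in>uhp. (inv \<beta> \<circ> \<sigma>) (\<phi> z) = (inv \<beta> \<circ> \<tau> \<circ> \<beta>) ((inv \<beta> \<circ> \<sigma>) z)"
    using semi by (simp add: ib)
  show ?thesis
    unfolding canonical_iff[OF X semi] canonical_iff[OF X semi']
    by (subst all[of "\<lambda>y. \<exists>z\<in>uhp. \<exists>n k. ((inv \<beta> \<circ> \<tau> \<circ> \<beta>) ^^ n) y = _ n k z"]) (simp only: o_apply[of "inv \<beta>" \<sigma>] Tn ibi)
qed

theorem theorem7p6:
  fixes \<phi> h \<sigma> \<tau> \<beta> :: "complex \<Rightarrow> complex" and z0 :: complex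
  assumes "parabolic_zero_step \<phi>"
    and "z0 \<in> uhp"
    and "BP_semiconj \<phi> z0 h"
    and "(\<sigma>, \<tau>) \<in> semiconj_solutions \<phi>"
    and "standardizes \<beta> \<tau>"
  shows "((\<exists>b. \<tau> = (\<lambda>z. z + b) \<and> \<beta> = (\<lambda>z. b * z) \<and> (\<exists>c. \<forall>z\<in>uhp. \<sigma> z = b * (h z + c)))
           \<longleftrightarrow> canonical \<phi> \<sigma> \<tau>)
       \<and> (canonical \<phi> \<sigma> \<tau> \<longleftrightarrow> univalence_covering \<phi> z0 (inv \<beta> \<circ> \<sigma>))"
proof -
  obtain p where p: "\<forall>z\<in>uhp. \<phi> z = z + p z \<and> Im (p z) > 0"
    and pz: "\<phi> holomorphic_on uhp"
      "\<exists>z\<in>uhp. (\<lambda>n. hyp_dist ((\<phi> ^^ n) z) ((\<phi> ^^ Suc n) z)) \<longlonglongrightarrow> 0"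
    using assms(1) unfolding parabolic_zero_step_def by (elim conjE exE)
  interpret zero_step \<phi> z0 h
  proof (rule zero_step.intro)
    show "Im z < Im (\<phi> z)" if "z \<in> uhp" for z
      using bspec[OF p that] by simp
  qed (fact pz assms)+
  have \<sigma>: "\<sigma> holomorphic_on uhp" and semi: "\<And>z. z \<in> uhp \<Longrightarrow> \<sigma> (\<phi> z) = \<tau> (\<sigma> z)"
    using assms(4) by (auto simp: semiconj_solutions_def)
  obtain a b where a: "a \<noteq> 0" and \<beta>: "\<beta> = (\<lambda>z. a * z + b)"
    using assms(5) by (auto simp: standardizes_def AutC_def)
  define T where "T = inv \<beta> \<circ> \<tau> \<circ> \<beta>"
  define f where "f = inv \<beta> \<circ> \<sigma>"
  have bij: "bij \<beta>"
    by (rule bij_betw_byWitness[of _ "\<lambda>z. (z - b) / a"]) (use a in \<open>auto simp: \<beta>\<close>)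
  have inv\<beta>: "inv \<beta> = (\<lambda>z. (z - b) / a)"
    by (rule inv_unique_comp) (use a in \<open>auto simp: \<beta> fun_eq_iff\<close>)
  have T: "T = (\<lambda>z. z + 1) \<and> \<beta> 0 = 0 \<or> (\<exists>a. a \<noteq> 0 \<and> T = (\<lambda>z. a * z))"
    using assms(5) unfolding standardizes_def T_def by blast
  have f_holo: "f holomorphic_on uhp"
    unfolding f_def inv\<beta> o_def using a by (intro holomorphic_intros \<sigma>) auto
  have f_semi: "f (\<phi> z) = T (f z)" if "z \<in> uhp" for z
    using semi[OF that] bij by (simp add: f_def T_def bij_is_surj surj_f_inv_f)
  have can: "canonical \<phi> f T \<longleftrightarrow> canonical \<phi> \<sigma> \<tau>"
    unfolding f_def T_def by (rule canonical_conjugate[OF _ _ bij]) (use phi_uhp semi in auto)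
  have "(\<exists>b. \<tau> = (\<lambda>z. z + b) \<and> \<beta> = (\<lambda>z. b * z) \<and> (\<exists>c. \<forall>z\<in>uhp. \<sigma> z = b * (h z + c))) \<longleftrightarrow>
      T = (\<lambda>z. z + 1) \<and> (\<exists>c. \<forall>z\<in>uhp. f z = h z + c)" (is "?a \<longleftrightarrow> ?A")
  proof
    assume ?a
    then obtain e c where e: "\<tau> = (\<lambda>z. z + e)" "\<beta> = (\<lambda>z. e * z)" "\<forall>z\<in>uhp. \<sigma> z = e * (h z + c)"
      by blast
    \<comment> \<open>Comparison of the two expressions for \<open>\<beta>\<close> at 0 and at
      1.\<close>
    have "b = 0" "e = a"
      using fun_cong[OF trans[OF \<beta>[symmetric] e(2)], of 0] fun_cong[OF trans[OF \<beta>[symmetric] e(2)], of 1]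
      by auto
    then show ?A
      using e a by (auto simp: T_def f_def inv\<beta> fun_eq_iff field_simps intro!: exI[of _ c])
  next
    assume A: ?A
    then obtain c where T1: "T = (\<lambda>z. z + 1)" and c: "\<forall>z\<in>uhp. f z = h z + c"
      by blast
    \<comment> \<open>A linear map fixes 0 but \<open>T 0 = 1\<close>, so the case with the
      normalisation \<open>\<beta> 0 = 0\<close> applies.\<close>
    have "b = 0"
      using T fun_cong[OF T1, of 0] by (auto simp: \<beta>)
    have "\<tau> z = z + a" for z
      using fun_cong[OF T1, of "z / a"] a \<open>b = 0\<close> by (simp add: T_def inv\<beta> o_def fun_cong[OF \<beta>] field_simps)
    moreover have "\<sigma> z = a * (h z + c)" if "z \<in> uhp" for z
      using c that a \<open>b = 0\<close> by (auto simp: f_def inv\<beta> field_simps)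
    ultimately show ?a
      using \<beta> \<open>b = 0\<close> by (intro exI[of _ a]) auto
  qed
  moreover have T': "T = (\<lambda>z. z + 1) \<or> (\<exists>a. a \<noteq> 0 \<and> T = (\<lambda>z. a * z))"
    using T by blast
  ultimately show ?thesis
    using canonical_solution_iff[OF f_holo f_semi T'] can unfolding f_def[symmetric] by blast
qed

end
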